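(* Let $\Omega\subset\mathbb{R}^m$ be a bounded domain, let $u\in W^{1,1}(\Omega)$, let $\vec F\in L^1(\Omega)$ be a vector field, and let $H\in L^\infty(\Omega)$. Then $u$ is a minimizer for $\mathcal{F}(u)=\int_\Omega\{|\nabla u+\vec F|+Hu\}$ if and only if $u$ is a weak solution to the equation $\operatorname{div}N(u)=H$ in $\Omega$.
   Context: $S(u)=\{\nabla u+\vec F=0\}$ is the singular set of $u$, and $N(u)=\frac{\nabla u+\vec F}{|\nabla u+\vec F|}$ on $\Omega\setminus S(u)$. $u\in W^{1,1}(\Omega)$ is a minimizer for $\mathcal{F}$ if $\mathcal{F}(u)\le\mathcal{F}(u+\varphi)$ for every $\varphi\in W^{1,1}_0(\Omega)$. A weakly differentiable function $u$ on $\Omega$ is a weak solution to $\operatorname{div}N(u)=H$ in $\Omega$ if for every $\varphi\in C_0^\infty(\Omega)$ $$\int_{S(u)}|\nabla\varphi|+\int_{\Omega\setminus S(u)}N(u)\cdot\nabla\varphi+\int_\Omega H\varphi\ge0.$$ *)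

theory Defs
  imports "HOL-Analysis.Analysis"
begin

text \<open>
  Functions on an open set \<open>\<Omega>\<close> are represented by total functions whose values
  outside \<open>\<Omega>\<close> are irrelevant.  The exception are test functions, which are extended by zero
  to the whole space.  \<open>L\<^sup>1(\<Omega>)\<close> is the library's \<^const>\<open>absolutely_integrable_on\<close>, that is,
  Lebesgue integrability on \<open>\<Omega>\<close>; measurability is with respect to the completed measure
  \<^const>\<open>lebesgue\<close>.
\<close>

primrec C_k :: "nat \<Rightarrow> ('a::euclidean_space \<Rightarrow> real) \<Rightarrow> bool" where
  "C_k 0 f \<longleftrightarrow> continuous_on UNIV f"
| "C_k (Suc k) f \<longleftrightarrow> (\<forall>x. f differentiable (at x)) \<and>
     (\<forall>i\<in>Basis. C_k k (\<lambda>x. frechet_derivative f (at x) i))"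

definition test_functions :: "'a::euclidean_space set \<Rightarrow> ('a \<Rightarrow> real) set" where
  "test_functions \<Omega> =
     {\<phi>. (\<forall>k. C_k k \<phi>) \<and> compact (closure {x. \<phi> x \<noteq> 0}) \<and> closure {x. \<phi> x \<noteq> 0} \<subseteq> \<Omega>}"

definition grad :: "('a::euclidean_space \<Rightarrow> real) \<Rightarrow> 'a \<Rightarrow> 'a" where
  "grad f x = (\<Sum>i\<in>Basis. frechet_derivative f (at x) i *\<^sub>R i)"

lemma GDERIV_grad:
  assumes "f differentiable (at x)"
  shows "GDERIV f x :> grad f x"
proof -
  have d: "(f has_derivative frechet_derivative f (at x)) (at x)"
    using assms by (simp add: frechet_derivative_works)
  have l: "linear (frechet_derivative f (at x))"
    using assms by (rule linear_frechet_derivative)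
  have "frechet_derivative f (at x) h = h \<bullet> grad f x" for h
  proof -
    have "frechet_derivative f (at x) h = frechet_derivative f (at x) (\<Sum>i\<in>Basis. (h \<bullet> i) *\<^sub>R i)"
      by (simp add: euclidean_representation)
    also have "\<dots> = (\<Sum>i\<in>Basis. (h \<bullet> i) * frechet_derivative f (at x) i)"
      by (simp add: linear_sum[OF l] linear_cmul[OF l])
    also have "\<dots> = h \<bullet> grad f x"
      by (simp add: grad_def inner_sum_right mult.commute)
    finally show ?thesis .
  qed
  then have "frechet_derivative f (at x) = (\<lambda>h. h \<bullet> grad f x)"
    by (rule ext)
  with d show ?thesis
    by (simp add: gderiv_def)
qed

definition locally_integrable_on ::
  "('a::euclidean_space \<Rightarrow> 'b::euclidean_space) \<Rightarrow> 'a set \<Rightarrow> bool" where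
  "locally_integrable_on f \<Omega> \<longleftrightarrow> (\<forall>K. compact K \<and> K \<subseteq> \<Omega> \<longrightarrow> f absolutely_integrable_on K)"

definition has_weak_gradient ::
  "'a::euclidean_space set \<Rightarrow> ('a \<Rightarrow> real) \<Rightarrow> ('a \<Rightarrow> 'a) \<Rightarrow> bool" where
  "has_weak_gradient \<Omega> u G \<longleftrightarrow>
     locally_integrable_on u \<Omega> \<and> locally_integrable_on G \<Omega> \<and>
     (\<forall>\<phi>\<in>test_functions \<Omega>.
        (LINT x:\<Omega>|lebesgue. u x *\<^sub>R grad \<phi> x) = - (LINT x:\<Omega>|lebesgue. \<phi> x *\<^sub>R G x))"

definition weakly_differentiable :: "'a::euclidean_space set \<Rightarrow> ('a \<Rightarrow> real) \<Rightarrow> bool" where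
  "weakly_differentiable \<Omega> u \<longleftrightarrow> (\<exists>G. has_weak_gradient \<Omega> u G)"

text \<open>
  The weak gradient is determined up to null sets only; \<open>weak_grad\<close> fixes a representative.
  For functions that are not weakly differentiable its value is meaningless.
\<close>

definition weak_grad :: "'a::euclidean_space set \<Rightarrow> ('a \<Rightarrow> real) \<Rightarrow> 'a \<Rightarrow> 'a" where
  "weak_grad \<Omega> u = (SOME G. has_weak_gradient \<Omega> u G)"

definition W11 :: "'a::euclidean_space set \<Rightarrow> ('a \<Rightarrow> real) set" where
  "W11 \<Omega> = {u. u absolutely_integrable_on \<Omega> \<and>
                (\<exists>G. has_weak_gradient \<Omega> u G \<and> G absolutely_integrable_on \<Omega>)}"

definition W11_norm :: "'a::euclidean_space set \<Rightarrow> ('a \<Rightarrow> real) \<Rightarrow> real" where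
  "W11_norm \<Omega> u =
     (LINT x:\<Omega>|lebesgue. \<bar>u x\<bar>) + (LINT x:\<Omega>|lebesgue. norm (weak_grad \<Omega> u x))"

text \<open>The closure of the test functions in \<open>W11 \<Omega>\<close> with respect to \<open>W11_norm\<close>.\<close>

definition W11_0 :: "'a::euclidean_space set \<Rightarrow> ('a \<Rightarrow> real) set" where
  "W11_0 \<Omega> = {u \<in> W11 \<Omega>. \<forall>e>0. \<exists>\<psi>\<in>test_functions \<Omega>. W11_norm \<Omega> (\<lambda>x. u x - \<psi> x) < e}"

definition L_infinity :: "'a::euclidean_space set \<Rightarrow> ('a \<Rightarrow> real) set" where
  "L_infinity \<Omega> = {H. H \<in> borel_measurable (lebesgue_on \<Omega>) \<and>
                       (\<exists>C. AE x in lebesgue_on \<Omega>. \<bar>H x\<bar> \<le> C)}"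

definition energy ::
  "'a::euclidean_space set \<Rightarrow> ('a \<Rightarrow> 'a) \<Rightarrow> ('a \<Rightarrow> real) \<Rightarrow> ('a \<Rightarrow> real) \<Rightarrow> real" where
  "energy \<Omega> F H u = (LINT x:\<Omega>|lebesgue. norm (weak_grad \<Omega> u x + F x) + H x * u x)"

definition minimizer ::
  "'a::euclidean_space set \<Rightarrow> ('a \<Rightarrow> 'a) \<Rightarrow> ('a \<Rightarrow> real) \<Rightarrow> ('a \<Rightarrow> real) \<Rightarrow> bool" where
  "minimizer \<Omega> F H u \<longleftrightarrow>
     u \<in> W11 \<Omega> \<and> (\<forall>\<phi>\<in>W11_0 \<Omega>. energy \<Omega> F H u \<le> energy \<Omega> F H (\<lambda>x. u x + \<phi> x))"

definition singular_set ::
  "'a::euclidean_space set \<Rightarrow> ('a \<Rightarrow> 'a) \<Rightarrow> ('a \<Rightarrow> real) \<Rightarrow> 'a set" where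
  "singular_set \<Omega> F u = {x \<in> \<Omega>. weak_grad \<Omega> u x + F x = 0}"

definition normal_field ::
  "'a::euclidean_space set \<Rightarrow> ('a \<Rightarrow> 'a) \<Rightarrow> ('a \<Rightarrow> real) \<Rightarrow> 'a \<Rightarrow> 'a" where
  "normal_field \<Omega> F u x =
     (weak_grad \<Omega> u x + F x) /\<^sub>R norm (weak_grad \<Omega> u x + F x)"

definition weak_solution ::
  "'a::euclidean_space set \<Rightarrow> ('a \<Rightarrow> 'a) \<Rightarrow> ('a \<Rightarrow> real) \<Rightarrow> ('a \<Rightarrow> real) \<Rightarrow> bool" where
  "weak_solution \<Omega> F H u \<longleftrightarrow>
     weakly_differentiable \<Omega> u \<and>
     (\<forall>\<phi>\<in>test_functions \<Omega>.
        (LINT x:singular_set \<Omega> F u|lebesgue. norm (grad \<phi> x))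
        + (LINT x:\<Omega> - singular_set \<Omega> F u|lebesgue. normal_field \<Omega> F u x \<bullet> grad \<phi> x)
        + (LINT x:\<Omega>|lebesgue. H x * \<phi> x) \<ge> 0)"

end

theory Submission
  imports Defs
begin

text \<open>
  Put \<open>V = \<nabla>u + F\<close>.  The left-hand side of the weak formulation is the one-sided derivative at
  \<open>t = 0\<close> of \<open>t \<mapsto> \<F>(u + t\<phi>)\<close>, because \<open>(|V + tw| - |V|) / t\<close> tends to \<open>|w|\<close> where \<open>V = 0\<close> and to
  \<open>V \<bullet> w / |V|\<close> elsewhere, dominated by \<open>|w|\<close>; so it is nonnegative for a minimizer.  Conversely, by
  convexity of the norm it is at most \<open>\<F>(u + \<phi>) - \<F>(u)\<close>, and \<open>\<F>\<close> is Lipschitz for the \<open>W\<^sup>1\<^sup>,\<^sup>1\<close> norm,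
  which passes the minimality from test functions to \<open>W\<^sub>0\<^sup>1\<^sup>,\<^sup>1\<close>.  Both directions need the weak gradient
  to be unique almost everywhere, hence linear; this comes from testing against smooth bumps that
  converge to the indicator functions of boxes.
\<close>

section \<open>Smooth bump functions\<close>

lemma C_k_SucI:
  assumes "\<And>x. (f has_derivative f' x) (at x)"
    and "\<And>i. i \<in> Basis \<Longrightarrow> C_k k (\<lambda>x. f' x i)"
  shows "C_k (Suc k) f"
proof -
  have "frechet_derivative f (at x) = f' x" for x
    using frechet_derivative_at[OF assms(1)] by simp
  then show ?thesis using assms by (auto simp: differentiable_def)
qed

lemma C_k_SucD:
  assumes "C_k (Suc k) f"
  shows "(f has_derivative frechet_derivative f (at x)) (at x)"
    and "i \<in> Basis \<Longrightarrow> C_k k (\<lambda>x. frechet_derivative f (at x) i)"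
  using assms by (auto simp: frechet_derivative_works)

text \<open>The recursion in \<open>C_k\<close> does not mention lower orders directly. They are
  needed for the product rule, where each summand keeps one factor undifferentiated.\<close>

lemma C_k_Suc_imp: "C_k (Suc k) f \<Longrightarrow> C_k k f"
proof (induction k arbitrary: f)
  case 0
  then have "f differentiable_on UNIV" by (auto simp: differentiable_on_def)
  then show ?case by (simp add: differentiable_imp_continuous_on)
next
  case (Suc k)
  show ?case
    using C_k_SucI[OF C_k_SucD(1)[OF Suc.prems] Suc.IH[OF C_k_SucD(2)[OF Suc.prems]]] .
qed

lemma C_k_const: "C_k k (\<lambda>x. c)"
proof (induction k arbitrary: c)
  case (Suc k)
  show ?case by (rule C_k_SucI[OF has_derivative_const]) (use Suc in simp)
qed simp

lemma C_k_add:
  assumes "C_k k f" "C_k k g"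
  shows "C_k k (\<lambda>x. f x + g x)"
  using assms
proof (induction k arbitrary: f g)
  case 0
  then show ?case by (simp add: continuous_on_add)
next
  case (Suc k)
  show ?case
    by (rule C_k_SucI[OF has_derivative_add[OF C_k_SucD(1)[OF Suc.prems(1)] C_k_SucD(1)[OF Suc.prems(2)]]],
        rule Suc.IH[OF C_k_SucD(2)[OF Suc.prems(1)] C_k_SucD(2)[OF Suc.prems(2)]])
qed

lemma C_k_mult:
  assumes "C_k k f" "C_k k g"
  shows "C_k k (\<lambda>x. f x * g x)"
  using assms
proof (induction k arbitrary: f g)
  case 0
  then show ?case by (simp add: continuous_on_mult)
next
  case (Suc k)
  show ?case
    by (rule C_k_SucI[OF has_derivative_mult[OF C_k_SucD(1)[OF Suc.prems(1)] C_k_SucD(1)[OF Suc.prems(2)]]],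
        intro C_k_add Suc.IH C_k_SucD(2)[OF Suc.prems(1)] C_k_SucD(2)[OF Suc.prems(2)]
          Suc.prems[THEN C_k_Suc_imp])
qed

lemma C_k_prod:
  assumes "\<And>i. i \<in> I \<Longrightarrow> C_k k (f i)"
  shows "C_k k (\<lambda>x. \<Prod>i\<in>I. f i x)"
  using assms by (induction I rule: infinite_finite_induct) (auto intro: C_k_const C_k_mult)

text \<open>
  The functions \<open>p(1/s) exp(-1/s)\<close>, extended by \<open>0\<close> to \<open>s \<le> 0\<close>, form a family that is closed under
  differentiation, so all of them are smooth.
\<close>

definition exp_inv :: "real poly \<Rightarrow> real \<Rightarrow> real" where
  "exp_inv p s = (if s > 0 then poly p (1 / s) * exp (- (1 / s)) else 0)"

lemma poly_exp_minus_tendsto_0: "((\<lambda>x. poly p x * exp (- x)) \<longlongrightarrow> (0::real)) at_top"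
proof -
  have "((\<lambda>x. \<Sum>i\<le>degree p. coeff p i * (x ^ i / exp x)) \<longlongrightarrow> (\<Sum>i\<le>degree p. coeff p i * 0)) at_top"
    by (intro tendsto_intros tendsto_power_div_exp_0)
  moreover have "(\<Sum>i\<le>degree p. coeff p i * (x ^ i / exp x)) = poly p x * exp (- x)" for x
    by (simp add: poly_altdef sum_distrib_right exp_minus divide_inverse mult.assoc)
  ultimately show ?thesis by simp
qed

lemma exp_inv_tendsto_0: "(exp_inv p \<longlongrightarrow> 0) (at_right 0)"
proof -
  have "((\<lambda>s. poly p (inverse s) * exp (- inverse s)) \<longlongrightarrow> 0) (at_right (0::real))"
    by (rule filterlim_compose[OF poly_exp_minus_tendsto_0 filterlim_inverse_at_top_right])
  moreover have "eventually (\<lambda>s. poly p (inverse s) * exp (- inverse s) = exp_inv p s) (at_right 0)"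
    by (auto simp: eventually_at_right_less exp_inv_def inverse_eq_divide intro: eventually_mono[OF eventually_at_right_less])
  ultimately show ?thesis by (rule Lim_transform_eventually)
qed

text \<open>For s > 0 the chain rule gives (1/s^2) (p - p')(1/s) exp(-1/s), and
  \<open>[:0, 0, 1:]\<close> is the polynomial X^2 that encodes 1/s^2. For s < 0 everything is
  constant, and at s = 0 exponential decay beats every polynomial in 1/s.\<close>

lemma DERIV_exp_inv:
  "(exp_inv p has_real_derivative exp_inv ([:0, 0, 1:] * (p - pderiv p)) s) (at s)"
proof -
  consider "s > 0" | "s < 0" | "s = 0" by linarith
  then show ?thesis
  proof cases
    case 1
    have "((\<lambda>s. poly p (1 / s) * exp (- (1 / s))) has_real_derivative
       exp_inv ([:0, 0, 1:] * (p - pderiv p)) s) (at s)"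
      using 1 by (auto intro!: derivative_eq_intros DERIV_chain2[OF poly_DERIV] simp: exp_inv_def field_simps power2_eq_square)
    then show ?thesis
      by (rule has_field_derivative_transform_within_open[where S="{0<..}"]) (use 1 in \<open>auto simp: exp_inv_def\<close>)
  next
    case 2
    have "((\<lambda>s. 0) has_real_derivative exp_inv ([:0, 0, 1:] * (p - pderiv p)) s) (at s)"
      using 2 by (simp add: exp_inv_def)
    then show ?thesis
      by (rule has_field_derivative_transform_within_open[where S="{..<0}"]) (use 2 in \<open>auto simp: exp_inv_def\<close>)
  next
    case 3
    have "((\<lambda>h. (exp_inv p (0 + h) - exp_inv p 0) / h) \<longlongrightarrow> 0) (at 0)"
    proof (rule filterlim_split_at)
      have "((\<lambda>h. 0::real) \<longlongrightarrow> 0) (at_left (0::real))" by simp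
      moreover have "eventually (\<lambda>h. 0 = (exp_inv p (0 + h) - exp_inv p 0) / h) (at_left 0)"
        by (auto simp: exp_inv_def eventually_at_filter)
      ultimately show "((\<lambda>h. (exp_inv p (0 + h) - exp_inv p 0) / h) \<longlongrightarrow> 0) (at_left 0)"
        by (rule Lim_transform_eventually)
      \<comment> \<open>Dividing by h multiplies by 1/h, so the right difference quotient is again a
        member of the family, with polynomial X p.\<close>
      have "eventually (\<lambda>h. exp_inv ([:0, 1:] * p) h = (exp_inv p (0 + h) - exp_inv p 0) / h) (at_right 0)"
        by (auto simp: exp_inv_def intro: eventually_mono[OF eventually_at_right_less])
      then show "((\<lambda>h. (exp_inv p (0 + h) - exp_inv p 0) / h) \<longlongrightarrow> 0) (at_right 0)"
        by (rule Lim_transform_eventually[OF exp_inv_tendsto_0])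
    qed
    then have "(exp_inv p has_real_derivative 0) (at 0)" by (simp add: DERIV_def)
    then show ?thesis using 3 by (simp add: exp_inv_def)
  qed
qed

text \<open>The derivative is a constant times another member of the family at the same affine
  argument. The induction therefore runs over all p at once.\<close>

lemma C_k_exp_inv: "C_k k (\<lambda>x. exp_inv p (c * (x \<bullet> v) + d))"
proof (induction k arbitrary: p)
  case 0
  have "isCont (exp_inv p) s" for s by (rule DERIV_isCont[OF DERIV_exp_inv])
  then have "continuous_on UNIV (exp_inv p)" by (simp add: continuous_on_eq_continuous_at)
  then show ?case
    by (auto intro!: continuous_on_compose2[where s=UNIV and f="\<lambda>x. c * (x \<bullet> v) + d"] continuous_intros)
next
  case (Suc k)
  define q where "q = [:0, 0, 1:] * (p - pderiv p)"
  show ?case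
  proof (rule C_k_SucI)
    fix x :: 'a
    have "((\<lambda>x. c * (x \<bullet> v) + d) has_derivative (\<lambda>h. c * (h \<bullet> v))) (at x)"
      by (auto intro!: derivative_eq_intros)
    from has_derivative_compose[OF this DERIV_exp_inv[unfolded has_field_derivative_def, of p, folded q_def]]
    show "((\<lambda>x. exp_inv p (c * (x \<bullet> v) + d)) has_derivative
        (\<lambda>h. exp_inv q (c * (x \<bullet> v) + d) * (c * (h \<bullet> v)))) (at x)" .
  next
    fix i :: 'a assume "i \<in> Basis"
    show "C_k k (\<lambda>x. exp_inv q (c * (x \<bullet> v) + d) * (c * (i \<bullet> v)))"
      by (intro C_k_mult C_k_const Suc)
  qed
qed

text \<open>Each pair of factors vanishes unless the i-th coordinate lies strictly between those of
  a and b. The factor n stretches the distances to the faces, so that exp(-1/(n r)) tends to 1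
  inside. The arguments are written as c (x . i) + d to match \<open>C_k_exp_inv\<close>.\<close>

definition box_bump :: "'a::euclidean_space \<Rightarrow> 'a \<Rightarrow> nat \<Rightarrow> 'a \<Rightarrow> real" where
  "box_bump a b n x =
     (\<Prod>i\<in>Basis. exp_inv 1 (real n * (x \<bullet> i) + - real n * (a \<bullet> i)) *
        exp_inv 1 (- real n * (x \<bullet> i) + real n * (b \<bullet> i)))"

lemma C_k_box_bump: "C_k k (box_bump a b n)"
  unfolding box_bump_def[abs_def] by (intro C_k_prod C_k_mult C_k_exp_inv)

lemma exp_inv_1_bounds: "0 \<le> exp_inv 1 s" "exp_inv 1 s \<le> 1"
  by (auto simp: exp_inv_def)

lemma box_bump_bounds: "0 \<le> box_bump a b n x" "box_bump a b n x \<le> 1"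
  unfolding box_bump_def
  by (auto intro!: prod_nonneg prod_le_1 mult_le_one exp_inv_1_bounds mult_nonneg_nonneg)

lemma box_bump_outside:
  assumes "x \<notin> box a b"
  shows "box_bump a b n x = 0"
proof -
  obtain i where i: "i \<in> Basis" "x \<bullet> i \<le> a \<bullet> i \<or> b \<bullet> i \<le> x \<bullet> i"
    using assms by (auto simp: mem_box not_less)
  then have "real n * (x \<bullet> i) + - real n * (a \<bullet> i) \<le> 0 \<or> - real n * (x \<bullet> i) + real n * (b \<bullet> i) \<le> 0"
    by (auto simp: mult_left_mono)
  then have "exp_inv 1 (real n * (x \<bullet> i) + - real n * (a \<bullet> i)) *
        exp_inv 1 (- real n * (x \<bullet> i) + real n * (b \<bullet> i)) = 0"
    by (auto simp: exp_inv_def)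
  then show ?thesis using i(1) unfolding box_bump_def by (intro prod_zero) auto
qed

lemma exp_inv_1_tendsto_1:
  assumes "r > 0"
  shows "(\<lambda>n. exp_inv 1 (real n * r)) \<longlonglongrightarrow> 1"
proof -
  have "(\<lambda>n. exp (- (1 / r) * inverse (real n))) \<longlonglongrightarrow> exp (- (1 / r) * 0)"
    by (intro tendsto_intros lim_inverse_n)
  moreover have "eventually (\<lambda>n. exp (- (1 / r) * inverse (real n)) = exp_inv 1 (real n * r)) sequentially"
    using eventually_gt_at_top[of 0] by eventually_elim (use assms in \<open>simp add: exp_inv_def field_simps\<close>)
  ultimately show ?thesis using Lim_transform_eventually by fastforce
qed

lemma box_bump_tendsto: "(\<lambda>n. box_bump a b n x) \<longlonglongrightarrow> indicator (box a b) x"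
proof (cases "x \<in> box a b")
  case True
  have "(\<lambda>n. \<Prod>i\<in>Basis. exp_inv 1 (real n * (x \<bullet> i - a \<bullet> i)) * exp_inv 1 (real n * (b \<bullet> i - x \<bullet> i)))
    \<longlonglongrightarrow> (\<Prod>i\<in>(Basis::'a set). 1 * 1)"
    by (intro tendsto_prod tendsto_mult exp_inv_1_tendsto_1) (use True in \<open>auto simp: mem_box\<close>)
  then show ?thesis using True by (simp add: box_bump_def algebra_simps)
qed (simp add: box_bump_outside)

lemma box_bump_test_function:
  assumes "cbox a b \<subseteq> \<Omega>"
  shows "box_bump a b n \<in> test_functions \<Omega>"
proof -
  have "{x. box_bump a b n x \<noteq> 0} \<subseteq> cbox a b"
    using box_bump_outside[of _ a b n] box_subset_cbox[of a b] by blast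
  then have *: "closure {x. box_bump a b n x \<noteq> 0} \<subseteq> cbox a b"
    by (rule closure_minimal[OF _ closed_cbox])
  then have "compact (closure {x. box_bump a b n x \<noteq> 0})"
    by (meson bounded_cbox bounded_subset closed_closure compact_eq_bounded_closed)
  then show ?thesis using * assms by (auto simp: test_functions_def C_k_box_bump)
qed

section \<open>The fundamental lemma of the calculus of variations\<close>

text \<open>On K the continuous factor is bounded and measurable, and off K the product vanishes. A
  general bilinear h covers both a scalar test function times a vector field and a scalar function
  times a gradient.\<close>

lemma integrable_continuous_bilinear_compact_support:
  fixes w :: "'a::euclidean_space \<Rightarrow> 'b::euclidean_space" and g :: "'a \<Rightarrow> 'c::euclidean_space"
    and h :: "'b \<Rightarrow> 'c \<Rightarrow> 'd::euclidean_space"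
  assumes h: "bounded_bilinear h"
    and w: "continuous_on UNIV w" "\<And>x. x \<notin> K \<Longrightarrow> w x = 0"
    and K: "compact K" and g: "g absolutely_integrable_on K"
  shows "integrable lebesgue (\<lambda>x. h (w x) (g x))"
proof -
  have "(\<lambda>x. h (w x) (g x)) absolutely_integrable_on K"
  proof (rule absolutely_integrable_bounded_measurable_product[where h=h and f=w and g=g, OF _ _ _ _ g])
    show "bilinear h" using h by (simp add: bilinear_conv_bounded_bilinear)
    show "K \<in> sets lebesgue" using K by (simp add: compact_imp_closed)
    show "w \<in> borel_measurable (lebesgue_on K)"
      using w(1) K by (meson continuous_imp_measurable_on_sets_lebesgue continuous_on_subset fmeasurableD lmeasurable_compact subset_UNIV)
    show "bounded (w ` K)"
      using w(1) K by (meson compact_continuous_image compact_imp_bounded continuous_on_subset subset_UNIV)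
  qed
  moreover have "indicator K x *\<^sub>R h (w x) (g x) = h (w x) (g x)" for x
    by (cases "x \<in> K") (simp_all add: w(2) bounded_bilinear.zero_left[OF h])
  ultimately show ?thesis by (simp add: set_integrable_def)
qed

text \<open>Required for \<open>sigma_finite_measure.density_zero\<close>. A countable cover by
  Borel sets of finite measure also serves the completion.\<close>

lemma sigma_finite_lebesgue: "sigma_finite_measure (lebesgue :: 'a::euclidean_space measure)"
proof
  obtain A :: "'a set set" where "countable A" "A \<subseteq> sets lborel" "\<Union>A = space lborel"
    "\<forall>a\<in>A. emeasure lborel a \<noteq> \<infinity>"
    using lborel.sigma_finite_countable by blast
  then show "\<exists>A::'a set set. countable A \<and> A \<subseteq> sets lebesgue \<and> \<Union>A = space lebesgue \<and>
      (\<forall>a\<in>A. emeasure lebesgue a \<noteq> \<infinity>)"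
    by (intro exI[of _ A]) (auto simp: subset_eq)
qed

text \<open>The bumps are test functions that converge to the indicator function of the open box and
  are bounded by it. Dominated convergence therefore carries the orthogonality over to the indicator
  function.\<close>

lemma integral_box_eq_0:
  fixes g :: "'a::euclidean_space \<Rightarrow> 'b::euclidean_space"
  assumes g: "g absolutely_integrable_on cbox a b"
    and ab: "cbox a b \<subseteq> \<Omega>"
    and orth: "\<And>\<phi>. \<phi> \<in> test_functions \<Omega> \<Longrightarrow> (LINT x:\<Omega>|lebesgue. \<phi> x *\<^sub>R g x) = 0"
  shows "(LINT x:box a b|lebesgue. g x) = 0"
proof -
  have cont: "continuous_on UNIV (box_bump a b n)" for n
    using C_k_box_bump[of 0 a b n] by simp
  have int: "integrable lebesgue (\<lambda>x. box_bump a b n x *\<^sub>R g x)" for n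
    by (rule integrable_continuous_bilinear_compact_support[OF bounded_bilinear_scaleR cont _ compact_cbox g])
      (use box_bump_outside box_subset_cbox in blast)
  have "set_integrable lebesgue (box a b) g"
    by (rule set_integrable_subset[OF g]) (simp_all add: box_subset_cbox)
  then have intb: "integrable lebesgue (\<lambda>x. indicator (box a b) x *\<^sub>R g x)"
    by (simp add: set_integrable_def)
  have "(\<lambda>n. LINT x|lebesgue. box_bump a b n x *\<^sub>R g x)
      \<longlonglongrightarrow> (LINT x|lebesgue. indicator (box a b) x *\<^sub>R g x)"
  proof (rule integral_dominated_convergence)
    show "integrable lebesgue (\<lambda>x. norm (indicator (box a b) x *\<^sub>R g x))"
      using intb by (rule integrable_norm)
    show "AE x in lebesgue. (\<lambda>n. box_bump a b n x *\<^sub>R g x) \<longlonglongrightarrow> indicator (box a b) x *\<^sub>R g x"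
      by (intro AE_I2 tendsto_scaleR box_bump_tendsto tendsto_const)
    show "AE x in lebesgue. norm (box_bump a b n x *\<^sub>R g x) \<le> norm (indicator (box a b) x *\<^sub>R g x)" for n
    proof (rule AE_I2)
      fix x
      show "norm (box_bump a b n x *\<^sub>R g x) \<le> norm (indicator (box a b) x *\<^sub>R g x)"
        by (cases "x \<in> box a b")
          (auto simp: box_bump_outside box_bump_bounds intro!: mult_left_le_one_le)
    qed
  qed (rule borel_measurable_integrable[OF intb] borel_measurable_integrable[OF int])+
  moreover have "(LINT x|lebesgue. box_bump a b n x *\<^sub>R g x) = 0" for n
  proof -
    \<comment> \<open>The bump vanishes off \<Omega>, so the integral over \<Omega> is the one over
      the whole space.\<close>
    have "indicator \<Omega> x *\<^sub>R (box_bump a b n x *\<^sub>R g x) = box_bump a b n x *\<^sub>R g x" for x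
      using ab box_subset_cbox[of a b] box_bump_outside[of x a b n] by (cases "x \<in> \<Omega>") auto
    then show ?thesis
      using orth[OF box_bump_test_function[OF ab, of n]] by (simp only: set_lebesgue_integral_def)
  qed
  ultimately show ?thesis by (simp add: set_lebesgue_integral_def LIMSEQ_const_iff)
qed

text \<open>A Dynkin argument: open boxes are stable under intersection and generate the Borel sets,
  and the sets over which the truncated function \<open>f\<close> has integral 0 are closed under
  complements and countable disjoint unions. A function whose integral over every measurable set is
  0 vanishes almost everywhere.\<close>

lemma AE_zero_on_box:
  fixes g :: "'a::euclidean_space \<Rightarrow> 'b::euclidean_space"
  assumes g: "g absolutely_integrable_on cbox a b"
    and boxes: "\<And>c d. box c d \<subseteq> box a b \<Longrightarrow> (LINT x:box c d|lebesgue. g x) = 0"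
  shows "AE x in lebesgue. x \<in> box a b \<longrightarrow> g x = 0"
proof -
  define f where "f x = indicator (box a b) x *\<^sub>R g x" for x
  have "set_integrable lebesgue (box a b) g"
    by (rule set_integrable_subset[OF g]) (simp_all add: box_subset_cbox)
  then have f: "integrable lebesgue f"
    by (simp add: set_integrable_def f_def[abs_def])
  have f_set: "set_integrable lebesgue A f" if "A \<in> sets lebesgue" for A
    using integrable_mult_indicator[OF that f] by (simp add: set_integrable_def)
  \<comment> \<open>Measurability is carried through the induction, because additivity of the
    integral in the complement and union cases uses it.\<close>
  have "A \<in> sets lebesgue \<and> (LINT x:A|lebesgue. f x) = 0" if A: "A \<in> sets borel" for A :: "'a set"
  proof -
    have "Int_stable (range (\<lambda>(a, b). box a b :: 'a set))"
      by (auto simp: Int_stable_def box_Int_box)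
    moreover have "(range (\<lambda>(a, b). box a b :: 'a set)) \<subseteq> Pow UNIV"
      by auto
    moreover have "A \<in> sigma_sets UNIV (range (\<lambda>(a, b). box a b))"
      using A unfolding borel_eq_box by simp
    ultimately show ?thesis
    proof (induction rule: sigma_sets_induct_disjoint)
      case (basic A)
      then obtain c d where A: "A = box c d" by auto
      obtain c' d' where cd: "box c d \<inter> box a b = box c' d'" by (auto simp: box_Int_box)
      have "(LINT x:A|lebesgue. f x) = (LINT x:box c' d'|lebesgue. g x)"
        unfolding set_lebesgue_integral_def A f_def cd[symmetric]
        by (intro Bochner_Integration.integral_cong) (auto simp: indicator_def)
      then show ?case using boxes[of c' d'] cd A by auto
    next
      case empty
      show ?case by (simp add: set_lebesgue_integral_def)
    next
      case (compl A)
      \<comment> \<open>The total integral of \<open>f\<close> is the integral of \<open>g\<close>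
        over \<open>box a b\<close>, which is 0 by \<open>boxes\<close>. Hence the complement of A
        also has integral 0.\<close>
      have "(LINT x:UNIV|lebesgue. f x) = (LINT x:A \<union> (UNIV - A)|lebesgue. f x)" by (simp only: Un_Diff_cancel Un_UNIV_right)
      also have "\<dots> = (LINT x:A|lebesgue. f x) + (LINT x:UNIV - A|lebesgue. f x)"
        using compl by (intro set_integral_Un f_set) auto
      also have "(LINT x:UNIV|lebesgue. f x) = (LINT x:box a b|lebesgue. g x)"
        by (simp add: set_lebesgue_integral_def f_def)
      finally show ?case using compl boxes[of a b] by auto
    next
      case (union F)
      then have F: "F i \<in> sets lebesgue" for i by blast
      moreover have "(LINT x:(\<Union>i. F i)|lebesgue. f x) = (\<Sum>i. (LINT x:F i|lebesgue. f x))"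
        by (rule lebesgue_integral_countable_add)
          (use F union.hyps(1) in \<open>auto simp: disjoint_family_on_def intro!: f_set sets.countable_UN\<close>)
      ultimately show ?case using union by auto
    qed
  qed note borel = this
  have "AE x in lebesgue. f x = 0"
  proof (rule sigma_finite_measure.density_zero[OF sigma_finite_lebesgue f])
    fix A :: "'a set" assume "A \<in> sets lebesgue"
    \<comment> \<open>A Lebesgue set is a Borel set up to a subset of a null set, so the Borel case
      suffices.\<close>
    then obtain S N N' where A: "A = S \<union> N" "N \<subseteq> N'" "N' \<in> null_sets lborel" "S \<in> sets lborel"
      by (rule sets_completionE)
    have "N' \<in> null_sets lebesgue" using A(3) by (rule null_sets_completionI)
    then have "AE x in lebesgue. x \<notin> N'" by (rule AE_not_in)
    then have "AE x in lebesgue. indicator A x *\<^sub>R f x = indicator S x *\<^sub>R f x"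
      by eventually_elim (use A in \<open>auto simp: indicator_def\<close>)
    moreover have "S \<in> sets lebesgue" using borel A by simp
    ultimately have "(LINT x:A|lebesgue. f x) = (LINT x:S|lebesgue. f x)"
      unfolding set_lebesgue_integral_def
      by (intro integral_cong_AE) (use f \<open>A \<in> sets lebesgue\<close> in \<open>auto intro!: borel_measurable_scaleR borel_measurable_indicator\<close>)
    then show "(LINT x:A|lebesgue. f x) = 0" using borel[of S] A by simp
  qed
  then show ?thesis by eventually_elim (auto simp: f_def)
qed

text \<open>Local integrability makes \<open>g\<close> integrable on each closed box inside
  \<Omega>, where the two preceding results apply. By Lindelof, countably many such boxes cover
  \<Omega>, so the exceptional null sets can be united.\<close>

lemma fundamental_lemma_variations:
  fixes g :: "'a::euclidean_space \<Rightarrow> 'b::euclidean_space"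
  assumes \<Omega>: "open \<Omega>" and g: "locally_integrable_on g \<Omega>"
    and orth: "\<And>\<phi>. \<phi> \<in> test_functions \<Omega> \<Longrightarrow> (LINT x:\<Omega>|lebesgue. \<phi> x *\<^sub>R g x) = 0"
  shows "AE x in lebesgue. x \<in> \<Omega> \<longrightarrow> g x = 0"
proof -
  define \<F> where "\<F> = {box a b | a b. cbox a b \<subseteq> \<Omega>}"
  obtain \<F>' where \<F>': "\<F>' \<subseteq> \<F>" "countable \<F>'" "\<Union>\<F>' = \<Union>\<F>"
    by (rule Lindelof[of \<F>]) (auto simp: \<F>_def)
  have "AE x in lebesgue. x \<in> B \<longrightarrow> g x = 0" if BF: "B \<in> \<F>" for B
  proof -
    obtain a b where B: "B = box a b" "cbox a b \<subseteq> \<Omega>" using BF by (auto simp: \<F>_def)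
    have int: "g absolutely_integrable_on cbox a b"
      using g B by (auto simp: locally_integrable_on_def)
    have "(LINT x:box c d|lebesgue. g x) = 0" if "box c d \<subseteq> box a b" for c d
    proof (cases "box c d = {}")
      case False
      \<comment> \<open>A nonempty open box has the closed box as its closure, so the inclusion
        passes to closed boxes. An empty \<open>box c d\<close> may have a nonempty degenerate
        \<open>cbox c d\<close>, hence the case split.\<close>
      then have "cbox c d \<subseteq> cbox a b"
        using closure_minimal[OF order_trans[OF that box_subset_cbox] closed_cbox] by (simp add: closure_box)
      then show ?thesis
        using integral_box_eq_0[OF absolutely_integrable_on_subcbox[OF int]] B orth by blast
    qed (simp add: set_lebesgue_integral_def)
    then show ?thesis using AE_zero_on_box[OF int] B by blast
  qed
  then have "AE x in lebesgue. \<forall>B\<in>\<F>'. x \<in> B \<longrightarrow> g x = 0"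
    using \<F>'(1) by (subst AE_ball_countable[OF \<F>'(2)]) blast
  moreover have "x \<in> \<Union>\<F>'" if x: "x \<in> \<Omega>" for x
  proof -
    obtain a b where "cbox a b \<subseteq> \<Omega>" "x \<in> box a b" using open_contains_cbox[OF \<Omega> x] .
    then show ?thesis unfolding \<F>'(3) \<F>_def by blast
  qed
  ultimately show ?thesis by (auto elim!: eventually_mono)
qed

section \<open>Test functions and integration by parts\<close>

lemma integrable_continuous_compact_support:
  fixes w :: "'a::euclidean_space \<Rightarrow> 'b::euclidean_space"
  assumes "continuous_on UNIV w" "\<And>x. x \<notin> K \<Longrightarrow> w x = 0" "compact K"
  shows "integrable lebesgue w"
proof -
  have "(\<lambda>x. 1 :: real) absolutely_integrable_on K"
    using assms(3) by (simp add: absolutely_integrable_on_iff_nonneg integrable_on_const lmeasurable_compact)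
  from integrable_continuous_bilinear_compact_support
      [OF bounded_bilinear.flip[OF bounded_bilinear_scaleR] assms this]
  show ?thesis by simp
qed

text \<open>
  The difference quotients have integral \<open>0\<close> by translation invariance, and converge dominatedly.
\<close>

lemma integral_partial_derivative_eq_0:
  fixes f :: "'a::euclidean_space \<Rightarrow> real"
  assumes f: "C_k 1 f" and K: "compact K" "\<And>x. x \<notin> K \<Longrightarrow> f x = 0" and i: "i \<in> Basis"
  shows "(LINT x|lebesgue. frechet_derivative f (at x) i) = 0"
proof -
  define D where "D x = frechet_derivative f (at x) i" for x
  have deriv: "(f has_derivative frechet_derivative f (at x)) (at x)" for x
    using f by (simp add: frechet_derivative_works)
  have cont_f: "continuous_on UNIV f"
    using deriv by (meson continuous_at_imp_continuous_on has_derivative_continuous)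
  have cont_D: "continuous_on UNIV D" using f i by (simp add: D_def[abs_def])
  have [measurable]: "f \<in> borel_measurable borel" "D \<in> borel_measurable borel"
    using cont_f cont_D by (auto intro: borel_measurable_continuous_onI)
  have dir: "((\<lambda>t. f (x + t *\<^sub>R i)) has_real_derivative D (x + t *\<^sub>R i)) (at t)" for x t
  proof -
    have "((\<lambda>t. x + t *\<^sub>R i) has_derivative (\<lambda>h. h *\<^sub>R i)) (at t)"
      by (auto intro!: derivative_eq_intros)
    from has_derivative_compose[OF this deriv]
    have "((\<lambda>t. f (x + t *\<^sub>R i)) has_derivative
        (\<lambda>h. frechet_derivative f (at (x + t *\<^sub>R i)) (h *\<^sub>R i))) (at t)" .
    moreover have "frechet_derivative f (at y) (h *\<^sub>R i) = h * D y" for h y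
      unfolding D_def using linear_cmul[OF has_derivative_linear[OF deriv[of y]]] by simp
    ultimately show ?thesis
      by (simp add: has_field_derivative_def mult.commute[of _ "D _"] cong: if_cong)
  qed
  obtain R where R: "\<And>x. x \<in> K \<Longrightarrow> norm x \<le> R"
    using compact_imp_bounded[OF K(1)] by (auto simp: bounded_iff)
  have "bounded (D ` cball 0 (R + 1))"
    by (meson cont_D compact_cball compact_continuous_image compact_imp_bounded continuous_on_subset subset_UNIV)
  then obtain B where B: "\<And>x. norm x \<le> R + 1 \<Longrightarrow> \<bar>D x\<bar> \<le> B"
    unfolding bounded_iff by (metis imageI mem_cball_0 real_norm_def)
  have D_out: "D x = 0" if "x \<notin> K" for x
  proof -
    have "(f has_derivative (\<lambda>h. 0)) (at x)"
      by (rule has_derivative_transform_within_open[OF has_derivative_const, where s="- K"])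
        (use K that in \<open>simp_all add: compact_imp_closed open_Compl\<close>)
    from frechet_derivative_at[OF this, symmetric] show ?thesis by (simp add: D_def)
  qed
  \<comment> \<open>The absolute value of \<open>B\<close> guards against an empty K: then R may be
    negative, the ball empty, and the sign of \<open>B\<close> undetermined.\<close>
  have B0: "\<bar>D x\<bar> \<le> \<bar>B\<bar>" for x
    using B[of x] R[of x] D_out[of x] by (cases "x \<in> K") auto
  define h :: "nat \<Rightarrow> real" where "h n = inverse (real (Suc n))" for n
  have h: "0 < h n" "h n \<le> 1" for n by (auto simp: h_def field_simps)
  have h0: "h \<longlonglongrightarrow> 0" unfolding h_def[abs_def] by (rule LIMSEQ_inverse_real_of_nat)
  define s where "s n x = (f (x + h n *\<^sub>R i) - f x) / h n" for n x
  have "(\<lambda>n. LINT x|lborel. s n x) \<longlonglongrightarrow> (LINT x|lborel. D x)"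
  proof (rule integral_dominated_convergence)
    \<comment> \<open>Steps \<open>h n\<close> are at most 1, so all difference quotients live in
      the ball of radius R + 1. The mean value theorem bounds them by a value of
      \<open>D\<close>.\<close>
    show "integrable lborel (\<lambda>x. indicator (cball 0 (R + 1)) x * \<bar>B\<bar>)"
      by (intro integrable_mult_left integrable_real_indicator) (auto intro: emeasure_bounded_finite[OF bounded_cball, simplified])
    show "AE x in lborel. (\<lambda>n. s n x) \<longlonglongrightarrow> D x"
    proof (rule AE_I2)
      fix x
      have "((\<lambda>t. (f (x + t *\<^sub>R i) - f x) / t) \<longlongrightarrow> D x) (at 0)"
        using dir[of x 0] by (simp add: DERIV_def)
      then have "(\<lambda>n. (f (x + h n *\<^sub>R i) - f x) / h n) \<longlonglongrightarrow> D x"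
      proof (rule filterlim_compose)
        have "h n \<noteq> 0" for n using h(1)[of n] by simp
        then show "filterlim h (at 0) sequentially" using h0 by (simp add: filterlim_at)
      qed
      then show "(\<lambda>n. s n x) \<longlonglongrightarrow> D x" by (simp add: s_def)
    qed
    show "AE x in lborel. norm (s n x) \<le> indicator (cball 0 (R + 1)) x * \<bar>B\<bar>" for n
    proof (rule AE_I2)
      fix x
      obtain z where "f (x + h n *\<^sub>R i) - f (x + 0 *\<^sub>R i) = (h n - 0) * D (x + z *\<^sub>R i)"
        using MVT2[OF h(1)[of n] dir[of x]] by blast
      then have "s n x = D (x + z *\<^sub>R i)" using h(1)[of n] by (simp add: s_def)
      then have "norm (s n x) \<le> \<bar>B\<bar>" using B0 by simp
      moreover have "s n x = 0" if "x \<notin> cball 0 (R + 1)"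
      proof -
        have "x \<notin> K" using R[of x] that by auto
        moreover have "norm x \<le> norm (x + h n *\<^sub>R i) + norm (h n *\<^sub>R i)"
          using norm_triangle_sub[of x "- (h n *\<^sub>R i)"] norm_triangle_ineq4[of "x + h n *\<^sub>R i" "h n *\<^sub>R i"] by simp
        then have "x + h n *\<^sub>R i \<notin> K" using R[of "x + h n *\<^sub>R i"] that h[of n] i by auto
        ultimately show ?thesis by (simp add: s_def K(2))
      qed
      ultimately show "norm (s n x) \<le> indicator (cball 0 (R + 1)) x * \<bar>B\<bar>"
        by (cases "x \<in> cball 0 (R + 1)") auto
    qed
  qed (simp_all add: s_def)
  moreover have "(LINT x|lborel. s n x) = 0" for n
  proof -
    have int: "integrable lborel f"
      using integrable_continuous_compact_support[OF cont_f K(2) K(1)] by (simp add: integrable_completion)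
    have eq: "(LINT x|lborel. f (x + h n *\<^sub>R i)) = (LINT x|lborel. f x)"
    proof -
      have "(LINT x|lborel. f x) = (LINT x|distr lborel borel ((+) (h n *\<^sub>R i)). f x)"
        by (simp add: lborel_distr_plus)
      also have "\<dots> = (LINT x|lborel. f (h n *\<^sub>R i + x))" by (rule integral_distr) auto
      finally show ?thesis by (simp add: add.commute)
    qed
    have "integrable (distr lborel borel ((+) (h n *\<^sub>R i))) f"
      using int by (simp add: lborel_distr_plus)
    then have "integrable lborel (\<lambda>x. f (x + h n *\<^sub>R i))"
      by (subst (asm) integrable_distr_eq) (auto simp: add.commute)
    then show ?thesis using int eq by (simp add: s_def)
  qed
  ultimately have "(LINT x|lborel. D x) = 0" by (simp add: LIMSEQ_const_iff)
  then show ?thesis unfolding D_def[symmetric] by (simp add: integral_completion)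
qed

lemma grad_inner_Basis: "i \<in> Basis \<Longrightarrow> grad f x \<bullet> i = frechet_derivative f (at x) i"
  unfolding grad_def inner_sum_left inner_scaleR_left
  by (subst sum.remove[of _ i]) (auto simp: inner_Basis intro!: sum.neutral)

section \<open>Regularity, supports and integrability of test functions\<close>

lemma test_functionD:
  fixes \<phi> :: "'a::euclidean_space \<Rightarrow> real"
  assumes "\<phi> \<in> test_functions \<Omega>"
  shows "C_k k \<phi>" "continuous_on UNIV \<phi>" "\<phi> differentiable (at x)" "continuous_on UNIV (grad \<phi>)"
proof -
  show C: "C_k k \<phi>" for k using assms by (simp add: test_functions_def)
  show "continuous_on UNIV \<phi>" using C[of 0] by simp
  show "\<phi> differentiable (at x)" using C[of 1] by simp
  show "continuous_on UNIV (grad \<phi>)"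
    unfolding grad_def[abs_def] using C[of 1] by (auto intro!: continuous_intros)
qed

lemma test_function_support:
  fixes \<phi> :: "'a::euclidean_space \<Rightarrow> real"
  assumes "\<phi> \<in> test_functions \<Omega>"
  obtains K where "compact K" "K \<subseteq> \<Omega>" "\<And>x. x \<notin> K \<Longrightarrow> \<phi> x = 0" "\<And>x. x \<notin> K \<Longrightarrow> grad \<phi> x = 0"
proof
  let ?K = "closure {x. \<phi> x \<noteq> 0}"
  show "compact ?K" "?K \<subseteq> \<Omega>" using assms by (auto simp: test_functions_def)
  show 0: "\<phi> x = 0" if "x \<notin> ?K" for x using that closure_subset[of "{x. \<phi> x \<noteq> 0}"] by blast
  show "grad \<phi> x = 0" if "x \<notin> ?K" for x
  proof -
    have "(\<phi> has_derivative (\<lambda>h. 0)) (at x)"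
    proof (rule has_derivative_transform_within_open[OF has_derivative_const])
      show "open (- ?K)" by (rule open_Compl[OF closed_closure])
      show "x \<in> - ?K" using that by blast
      show "0 = \<phi> y" if "y \<in> - ?K" for y using 0[of y] that by simp
    qed
    from frechet_derivative_at[OF this, symmetric] show ?thesis by (simp add: grad_def)
  qed
qed

lemma set_integral_eq_of_support:
  assumes "\<And>x. x \<notin> A \<Longrightarrow> f x = 0"
  shows "(LINT x:A|M. f x) = (LINT x|M. f x)" "set_integrable M A f \<longleftrightarrow> integrable M f"
proof -
  have "indicator A x *\<^sub>R f x = f x" for x using assms[of x] by (cases "x \<in> A") auto
  then show "(LINT x:A|M. f x) = (LINT x|M. f x)" "set_integrable M A f \<longleftrightarrow> integrable M f"
    by (simp_all add: set_lebesgue_integral_def set_integrable_def)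
qed

lemma integrable_test_function:
  fixes \<phi> :: "'a::euclidean_space \<Rightarrow> real"
  assumes \<phi>: "\<phi> \<in> test_functions \<Omega>"
  shows "integrable lebesgue \<phi>" "integrable lebesgue (grad \<phi>)"
    and "\<phi> absolutely_integrable_on \<Omega>" "grad \<phi> absolutely_integrable_on \<Omega>"
proof -
  obtain K where K: "compact K" "K \<subseteq> \<Omega>" "\<And>x. x \<notin> K \<Longrightarrow> \<phi> x = 0" "\<And>x. x \<notin> K \<Longrightarrow> grad \<phi> x = 0"
    using test_function_support[OF \<phi>] by blast
  show 1: "integrable lebesgue \<phi>" "integrable lebesgue (grad \<phi>)"
    using integrable_continuous_compact_support[OF test_functionD(2)[OF \<phi>] K(3) K(1)]
      integrable_continuous_compact_support[OF test_functionD(4)[OF \<phi>] K(4) K(1)] by auto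
  show "\<phi> absolutely_integrable_on \<Omega>" "grad \<phi> absolutely_integrable_on \<Omega>"
    using 1 set_integral_eq_of_support(2)[of \<Omega> \<phi> lebesgue] set_integral_eq_of_support(2)[of \<Omega> "grad \<phi>" lebesgue] K
    by (meson subset_eq)+
qed

text \<open>Shows that both integrands in \<open>has_weak_gradient\<close> are integrable, so that
  the defining identity can be added and subtracted. Local integrability suffices because the
  products live on a compact subset of \<Omega>.\<close>

lemma integrable_test_function_mult:
  fixes g :: "'a::euclidean_space \<Rightarrow> 'b::euclidean_space" and f :: "'a \<Rightarrow> real"
  assumes \<phi>: "\<phi> \<in> test_functions \<Omega>"
  shows "locally_integrable_on g \<Omega> \<Longrightarrow> set_integrable lebesgue \<Omega> (\<lambda>x. \<phi> x *\<^sub>R g x)"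
    and "locally_integrable_on f \<Omega> \<Longrightarrow> set_integrable lebesgue \<Omega> (\<lambda>x. f x *\<^sub>R grad \<phi> x)"
proof -
  obtain K where K: "compact K" "K \<subseteq> \<Omega>" "\<And>x. x \<notin> K \<Longrightarrow> \<phi> x = 0" "\<And>x. x \<notin> K \<Longrightarrow> grad \<phi> x = 0"
    using test_function_support[OF \<phi>] by blast
  show "set_integrable lebesgue \<Omega> (\<lambda>x. \<phi> x *\<^sub>R g x)" if "locally_integrable_on g \<Omega>"
  proof (subst set_integral_eq_of_support(2))
    show "integrable lebesgue (\<lambda>x. \<phi> x *\<^sub>R g x)"
      by (rule integrable_continuous_bilinear_compact_support[OF bounded_bilinear_scaleR test_functionD(2)[OF \<phi>] K(3) K(1)])
        (use that K in \<open>auto simp: locally_integrable_on_def\<close>)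
  qed (use K in auto)
  show "set_integrable lebesgue \<Omega> (\<lambda>x. f x *\<^sub>R grad \<phi> x)" if "locally_integrable_on f \<Omega>"
  proof (subst set_integral_eq_of_support(2))
    show "integrable lebesgue (\<lambda>x. f x *\<^sub>R grad \<phi> x)"
      by (rule integrable_continuous_bilinear_compact_support[OF bounded_bilinear.flip[OF bounded_bilinear_scaleR] test_functionD(4)[OF \<phi>] K(4) K(1)])
        (use that K in \<open>auto simp: locally_integrable_on_def\<close>)
  qed (use K in auto)
qed

lemma absolutely_integrable_imp_locally:
  "f absolutely_integrable_on \<Omega> \<Longrightarrow> locally_integrable_on f \<Omega>"
  unfolding locally_integrable_on_def
  by (blast intro: set_integrable_subset fmeasurableD lmeasurable_compact)

text \<open>Integration by parts, one coordinate at a time: the partial derivatives of \<phi> \<psi>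
  have integral 0, and the product rule splits them into the two required terms.\<close>

lemma test_function_has_weak_gradient:
  fixes \<phi> :: "'a::euclidean_space \<Rightarrow> real"
  assumes \<phi>: "\<phi> \<in> test_functions \<Omega>"
  shows "has_weak_gradient \<Omega> \<phi> (grad \<phi>)"
proof -
  have loc: "locally_integrable_on \<phi> \<Omega>" "locally_integrable_on (grad \<phi>) \<Omega>"
    using integrable_test_function[OF \<phi>] by (auto intro: absolutely_integrable_imp_locally)
  have "(LINT x:\<Omega>|lebesgue. \<phi> x *\<^sub>R grad \<psi> x) = - (LINT x:\<Omega>|lebesgue. \<psi> x *\<^sub>R grad \<phi> x)"
    if \<psi>: "\<psi> \<in> test_functions \<Omega>" for \<psi>
  proof (rule euclidean_eqI)
    fix i :: 'a assume i: "i \<in> Basis"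
    obtain K where K: "compact K" "K \<subseteq> \<Omega>" "\<And>x. x \<notin> K \<Longrightarrow> \<phi> x = 0" "\<And>x. x \<notin> K \<Longrightarrow> grad \<phi> x = 0"
      using test_function_support[OF \<phi>] by blast
    have out: "\<phi> x = 0" "grad \<phi> x = 0" if "x \<notin> \<Omega>" for x
      using K that by auto
    have int: "integrable lebesgue (\<lambda>x. \<phi> x *\<^sub>R grad \<psi> x)" "integrable lebesgue (\<lambda>x. \<psi> x *\<^sub>R grad \<phi> x)"
      using integrable_test_function_mult(2)[OF \<psi> loc(1)] integrable_test_function_mult(1)[OF \<psi> loc(2)]
        set_integral_eq_of_support(2)[of \<Omega> "\<lambda>x. \<phi> x *\<^sub>R grad \<psi> x" lebesgue]
        set_integral_eq_of_support(2)[of \<Omega> "\<lambda>x. \<psi> x *\<^sub>R grad \<phi> x" lebesgue]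
      by (simp_all add: out)
    have prod: "((\<lambda>x. \<phi> x * \<psi> x) has_derivative
        (\<lambda>h. \<phi> x * frechet_derivative \<psi> (at x) h + frechet_derivative \<phi> (at x) h * \<psi> x)) (at x)" for x
      by (intro has_derivative_mult frechet_derivative_works[THEN iffD1] test_functionD(3)[OF \<phi>] test_functionD(3)[OF \<psi>])
    have "(LINT x|lebesgue. frechet_derivative (\<lambda>x. \<phi> x * \<psi> x) (at x) i) = 0"
      by (rule integral_partial_derivative_eq_0[OF C_k_mult[OF test_functionD(1)[OF \<phi>] test_functionD(1)[OF \<psi>]] K(1) _ i])
        (simp add: K(3))
    also have "(\<lambda>x. frechet_derivative (\<lambda>x. \<phi> x * \<psi> x) (at x) i)
        = (\<lambda>x. (\<phi> x *\<^sub>R grad \<psi> x) \<bullet> i + (\<psi> x *\<^sub>R grad \<phi> x) \<bullet> i)"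
      using i by (intro ext) (simp add: frechet_derivative_at[OF prod, symmetric] grad_inner_Basis)
    also have "(LINT x|lebesgue. \<dots> x) = (LINT x|lebesgue. \<phi> x *\<^sub>R grad \<psi> x) \<bullet> i + (LINT x|lebesgue. \<psi> x *\<^sub>R grad \<phi> x) \<bullet> i"
      by (subst Bochner_Integration.integral_add)
        (use int in \<open>auto simp only: integral_inner_left integrable_inner_left\<close>)
    finally show "(LINT x:\<Omega>|lebesgue. \<phi> x *\<^sub>R grad \<psi> x) \<bullet> i = - (LINT x:\<Omega>|lebesgue. \<psi> x *\<^sub>R grad \<phi> x) \<bullet> i"
      using set_integral_eq_of_support(1)[of \<Omega> "\<lambda>x. \<phi> x *\<^sub>R grad \<psi> x" lebesgue]
        set_integral_eq_of_support(1)[of \<Omega> "\<lambda>x. \<psi> x *\<^sub>R grad \<phi> x" lebesgue]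
      by (simp add: out)
  qed
  then show ?thesis using loc by (simp add: has_weak_gradient_def)
qed

section \<open>Weak gradients and \<open>W\<^sup>1\<^sup>,\<^sup>1\<close>\<close>

lemma has_weak_gradient_add_scaled:
  assumes u: "has_weak_gradient \<Omega> u G" and v: "has_weak_gradient \<Omega> v G'"
  shows "has_weak_gradient \<Omega> (\<lambda>x. u x + c * v x) (\<lambda>x. G x + c *\<^sub>R G' x)"
proof -
  have loc: "locally_integrable_on u \<Omega>" "locally_integrable_on G \<Omega>"
    "locally_integrable_on v \<Omega>" "locally_integrable_on G' \<Omega>"
    using u v by (auto simp: has_weak_gradient_def)
  have "locally_integrable_on (\<lambda>x. u x + c * v x) \<Omega>" "locally_integrable_on (\<lambda>x. G x + c *\<^sub>R G' x) \<Omega>"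
    using loc by (simp_all add: locally_integrable_on_def)
  moreover have "(LINT x:\<Omega>|lebesgue. (u x + c * v x) *\<^sub>R grad \<phi> x) =
      - (LINT x:\<Omega>|lebesgue. \<phi> x *\<^sub>R (G x + c *\<^sub>R G' x))" if \<phi>: "\<phi> \<in> test_functions \<Omega>" for \<phi>
  proof -
    have 1: "(\<lambda>x. (u x + c * v x) *\<^sub>R grad \<phi> x) = (\<lambda>x. u x *\<^sub>R grad \<phi> x + c *\<^sub>R (v x *\<^sub>R grad \<phi> x))"
      by (simp add: algebra_simps)
    have 2: "(\<lambda>x. \<phi> x *\<^sub>R (G x + c *\<^sub>R G' x)) = (\<lambda>x. \<phi> x *\<^sub>R G x + c *\<^sub>R (\<phi> x *\<^sub>R G' x))"
      by (simp add: algebra_simps)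
    have 3: "(LINT x:\<Omega>|lebesgue. u x *\<^sub>R grad \<phi> x) = - (LINT x:\<Omega>|lebesgue. \<phi> x *\<^sub>R G x)"
      "(LINT x:\<Omega>|lebesgue. v x *\<^sub>R grad \<phi> x) = - (LINT x:\<Omega>|lebesgue. \<phi> x *\<^sub>R G' x)"
      using u v \<phi> by (auto simp: has_weak_gradient_def)
    note int = integrable_test_function_mult(2)[OF \<phi> loc(1)] integrable_test_function_mult(2)[OF \<phi> loc(3)]
      integrable_test_function_mult(1)[OF \<phi> loc(2)] integrable_test_function_mult(1)[OF \<phi> loc(4)]
    show ?thesis
      unfolding 1 2
        set_integral_add(2)[OF int(1) set_integrable_scaleR_right[OF int(2)]]
        set_integral_add(2)[OF int(3) set_integrable_scaleR_right[OF int(4)]]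
      by (simp only: set_integral_scaleR_right 3 scaleR_minus_right minus_add_distrib)
  qed
  ultimately show ?thesis by (simp add: has_weak_gradient_def)
qed

text \<open>Both fields give the same integral against every test function, so the fundamental lemma
  applies to their difference.\<close>

lemma has_weak_gradient_unique:
  assumes \<Omega>: "open \<Omega>" and G: "has_weak_gradient \<Omega> u G" and G': "has_weak_gradient \<Omega> u G'"
  shows "AE x in lebesgue. x \<in> \<Omega> \<longrightarrow> G x = G' x"
proof -
  have loc: "locally_integrable_on G \<Omega>" "locally_integrable_on G' \<Omega>"
    using G G' by (auto simp: has_weak_gradient_def)
  have "AE x in lebesgue. x \<in> \<Omega> \<longrightarrow> G x - G' x = 0"
  proof (rule fundamental_lemma_variations[OF \<Omega>])
    show "locally_integrable_on (\<lambda>x. G x - G' x) \<Omega>"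
      using loc by (simp add: locally_integrable_on_def)
    fix \<phi> :: "'a \<Rightarrow> real" assume \<phi>: "\<phi> \<in> test_functions \<Omega>"
    have "- (LINT x:\<Omega>|lebesgue. \<phi> x *\<^sub>R G x) = - (LINT x:\<Omega>|lebesgue. \<phi> x *\<^sub>R G' x)"
      using G G' \<phi> unfolding has_weak_gradient_def by metis
    then show "(LINT x:\<Omega>|lebesgue. \<phi> x *\<^sub>R (G x - G' x)) = 0"
      using integrable_test_function_mult(1)[OF \<phi> loc(1)] integrable_test_function_mult(1)[OF \<phi> loc(2)]
      by (simp add: scaleR_diff_right set_integral_diff(2))
  qed
  then show ?thesis by simp
qed

lemma has_weak_gradient_weak_grad:
  "has_weak_gradient \<Omega> u G \<Longrightarrow> has_weak_gradient \<Omega> u (weak_grad \<Omega> u)"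
  unfolding weak_grad_def by (rule someI[of "has_weak_gradient \<Omega> u"])

lemma weak_grad_AE_eq:
  assumes "open \<Omega>" "has_weak_gradient \<Omega> u G"
  shows "AE x in lebesgue. x \<in> \<Omega> \<longrightarrow> weak_grad \<Omega> u x = G x"
  using has_weak_gradient_unique[OF assms(1) has_weak_gradient_weak_grad[OF assms(2)] assms(2)] .

lemma absolutely_integrable_AE_eq:
  fixes f g :: "'a::euclidean_space \<Rightarrow> 'b::euclidean_space"
  assumes f: "f absolutely_integrable_on S" and eq: "AE x in lebesgue. x \<in> S \<longrightarrow> g x = f x"
  shows "g absolutely_integrable_on S"
proof -
  obtain N where N: "N \<in> null_sets lebesgue" "\<And>x. x \<notin> N \<Longrightarrow> x \<in> S \<longrightarrow> g x = f x"
    using eq unfolding completion.AE_iff_null_sets by auto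
  show ?thesis
    by (rule absolutely_integrable_spike[OF f]) (use N in \<open>auto simp: negligible_iff_null_sets\<close>)
qed

text \<open>Membership in \<open>W11\<close> makes some weak gradient integrable. Uniqueness almost
  everywhere transfers this to the representative chosen by \<open>weak_grad\<close>.\<close>

lemma W11D:
  assumes \<Omega>: "open \<Omega>" and u: "u \<in> W11 \<Omega>"
  shows "u absolutely_integrable_on \<Omega>" "has_weak_gradient \<Omega> u (weak_grad \<Omega> u)"
    and "weak_grad \<Omega> u absolutely_integrable_on \<Omega>"
proof -
  obtain G where G: "has_weak_gradient \<Omega> u G" "G absolutely_integrable_on \<Omega>"
    using u by (auto simp: W11_def)
  show "u absolutely_integrable_on \<Omega>" using u by (simp add: W11_def)
  show "has_weak_gradient \<Omega> u (weak_grad \<Omega> u)" using G(1) by (rule has_weak_gradient_weak_grad)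
  show "weak_grad \<Omega> u absolutely_integrable_on \<Omega>"
    by (rule absolutely_integrable_AE_eq[OF G(2) weak_grad_AE_eq[OF \<Omega> G(1)]])
qed

text \<open>The choice in \<open>weak_grad\<close> need not be linear pointwise, so linearity is
  only claimed almost everywhere. Later c = 1 gives perturbations and c = -1 gives
  differences.\<close>

lemma W11_add_scaled:
  assumes "open \<Omega>" "u \<in> W11 \<Omega>" "v \<in> W11 \<Omega>"
  shows "(\<lambda>x. u x + c * v x) \<in> W11 \<Omega>"
    and "AE x in lebesgue. x \<in> \<Omega> \<longrightarrow>
      weak_grad \<Omega> (\<lambda>x. u x + c * v x) x = weak_grad \<Omega> u x + c *\<^sub>R weak_grad \<Omega> v x"
proof -
  note u = W11D[OF assms(1,2)] and v = W11D[OF assms(1,3)]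
  note G = has_weak_gradient_add_scaled[OF u(2) v(2), of c]
  have "(\<lambda>x. u x + c * v x) absolutely_integrable_on \<Omega>"
    "(\<lambda>x. weak_grad \<Omega> u x + c *\<^sub>R weak_grad \<Omega> v x) absolutely_integrable_on \<Omega>"
    using u v by simp_all
  with G show "(\<lambda>x. u x + c * v x) \<in> W11 \<Omega>"
    unfolding W11_def by blast
  show "AE x in lebesgue. x \<in> \<Omega> \<longrightarrow>
      weak_grad \<Omega> (\<lambda>x. u x + c * v x) x = weak_grad \<Omega> u x + c *\<^sub>R weak_grad \<Omega> v x"
    by (rule weak_grad_AE_eq[OF assms(1) G])
qed

section \<open>Test functions as elements of \<open>W11\<close> and \<open>W11_0\<close>\<close>

lemma test_function_W11:
  assumes "\<phi> \<in> test_functions \<Omega>"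
  shows "\<phi> \<in> W11 \<Omega>"
  using test_function_has_weak_gradient[OF assms] integrable_test_function[OF assms]
  unfolding W11_def by blast

lemma weak_grad_test_function:
  assumes "open \<Omega>" "\<phi> \<in> test_functions \<Omega>"
  shows "AE x in lebesgue. x \<in> \<Omega> \<longrightarrow> weak_grad \<Omega> \<phi> x = grad \<phi> x"
  by (rule weak_grad_AE_eq[OF assms(1) test_function_has_weak_gradient[OF assms(2)]])

lemma test_function_cmult:
  fixes \<phi> :: "'a::euclidean_space \<Rightarrow> real"
  assumes \<phi>: "\<phi> \<in> test_functions \<Omega>"
  shows "(\<lambda>x. c * \<phi> x) \<in> test_functions \<Omega>" "grad (\<lambda>x. c * \<phi> x) x = c *\<^sub>R grad \<phi> x"
proof -
  have "closure {x. c * \<phi> x \<noteq> 0} \<subseteq> closure {x. \<phi> x \<noteq> 0}"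
    by (rule closure_mono) auto
  moreover have "compact (closure {x. \<phi> x \<noteq> 0})" "closure {x. \<phi> x \<noteq> 0} \<subseteq> \<Omega>"
    using \<phi> by (auto simp: test_functions_def)
  moreover from calculation have "compact (closure {x. c * \<phi> x \<noteq> 0})"
    by (meson bounded_subset closed_closure compact_eq_bounded_closed)
  moreover have "C_k k (\<lambda>x. c * \<phi> x)" for k
    by (rule C_k_mult[OF C_k_const test_functionD(1)[OF \<phi>]])
  ultimately show "(\<lambda>x. c * \<phi> x) \<in> test_functions \<Omega>"
    unfolding test_functions_def by blast
  have "((\<lambda>x. c * \<phi> x) has_derivative (\<lambda>h. c * frechet_derivative \<phi> (at x) h)) (at x)"
    by (intro has_derivative_mult_right frechet_derivative_works[THEN iffD1] test_functionD(3)[OF \<phi>])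
  from frechet_derivative_at[OF this, symmetric]
  show "grad (\<lambda>x. c * \<phi> x) x = c *\<^sub>R grad \<phi> x"
    by (simp add: grad_def scaleR_sum_right)
qed

text \<open>Even the zero function has a chosen gradient that is only known to vanish almost
  everywhere. The result lets a test function approximate itself in \<open>W11_0\<close>.\<close>

lemma W11_norm_zero:
  assumes "open \<Omega>"
  shows "W11_norm \<Omega> (\<lambda>x. 0) = 0"
proof -
  have "has_weak_gradient \<Omega> (\<lambda>x. 0) (\<lambda>x. 0)"
    by (simp add: has_weak_gradient_def locally_integrable_on_def)
  from weak_grad_AE_eq[OF assms this]
  have "AE x in lebesgue. indicator \<Omega> x *\<^sub>R norm (weak_grad \<Omega> (\<lambda>x. 0) x) = 0"
    by eventually_elim (auto simp: indicator_def)
  then have "(LINT x:\<Omega>|lebesgue. norm (weak_grad \<Omega> (\<lambda>x. 0) x)) = 0"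
    unfolding set_lebesgue_integral_def by (rule integral_eq_zero_AE)
  then show ?thesis by (simp add: W11_norm_def)
qed

lemma test_function_W11_0:
  assumes "open \<Omega>" "\<phi> \<in> test_functions \<Omega>"
  shows "\<phi> \<in> W11_0 \<Omega>"
  unfolding W11_0_def using assms test_function_W11[OF assms(2)]
  by (auto intro!: bexI[of _ \<phi>] simp: W11_norm_zero)

section \<open>The energy and its first variation\<close>

lemma set_integral_cong_AE_integrable:
  fixes f g :: "'a \<Rightarrow> 'b::{banach, second_countable_topology}"
  assumes "set_integrable M A f" "set_integrable M A g" "AE x in M. x \<in> A \<longrightarrow> f x = g x"
  shows "(LINT x:A|M. f x) = (LINT x:A|M. g x)"
  unfolding set_lebesgue_integral_def
proof (rule integral_cong_AE)
  show "AE x in M. indicator A x *\<^sub>R f x = indicator A x *\<^sub>R g x"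
    using assms(3) by eventually_elim (auto simp: indicator_def)
qed (use assms in \<open>auto simp: set_integrable_def\<close>)

lemma L_infinity_bound:
  assumes \<Omega>: "open \<Omega>" and H: "H \<in> L_infinity \<Omega>"
  obtains C where "C \<ge> 0" "AE x in lebesgue. x \<in> \<Omega> \<longrightarrow> \<bar>H x\<bar> \<le> C"
proof -
  obtain C where "AE x in lebesgue_on \<Omega>. \<bar>H x\<bar> \<le> C" using H by (auto simp: L_infinity_def)
  then have "AE x in lebesgue. x \<in> \<Omega> \<longrightarrow> \<bar>H x\<bar> \<le> C"
    by (subst (asm) AE_restrict_space_iff) (use \<Omega> in auto)
  then have "AE x in lebesgue. x \<in> \<Omega> \<longrightarrow> \<bar>H x\<bar> \<le> max 0 C"
    by eventually_elim auto
  then show ?thesis by (intro that[of "max 0 C"]) auto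
qed

lemma L_infinity_mult_integrable:
  fixes f :: "'a::euclidean_space \<Rightarrow> real"
  assumes \<Omega>: "open \<Omega>" and H: "H \<in> L_infinity \<Omega>" and f: "f absolutely_integrable_on \<Omega>"
  shows "(\<lambda>x. H x * f x) absolutely_integrable_on \<Omega>"
proof -
  obtain C where C: "C \<ge> 0" "AE x in lebesgue. x \<in> \<Omega> \<longrightarrow> \<bar>H x\<bar> \<le> C"
    using L_infinity_bound[OF \<Omega> H] .
  \<comment> \<open>\<open>H\<close> is measurable only relative to \<Omega>, so each factor is cut
    off before the product is formed; the indicator function is its own square.\<close>
  have "(\<lambda>x. indicator \<Omega> x *\<^sub>R H x) \<in> borel_measurable lebesgue"
    using H \<Omega> by (subst borel_measurable_restrict_space_iff[symmetric]) (auto simp: L_infinity_def)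
  moreover have "(\<lambda>x. indicator \<Omega> x *\<^sub>R f x) \<in> borel_measurable lebesgue"
    using f by (auto simp: set_integrable_def)
  ultimately have "(\<lambda>x. (indicator \<Omega> x *\<^sub>R H x) * (indicator \<Omega> x *\<^sub>R f x)) \<in> borel_measurable lebesgue"
    by (rule borel_measurable_times)
  also have "(\<lambda>x. (indicator \<Omega> x *\<^sub>R H x) * (indicator \<Omega> x *\<^sub>R f x)) = (\<lambda>x. indicator \<Omega> x *\<^sub>R (H x * f x))"
    by (auto simp: indicator_def)
  finally have "set_borel_measurable lebesgue \<Omega> (\<lambda>x. H x * f x)"
    by (simp add: set_borel_measurable_def)
  moreover have "AE x in lebesgue. x \<in> \<Omega> \<longrightarrow> norm (H x * f x) \<le> norm (C * f x)"
    using C(2) by eventually_elim (use C(1) in \<open>auto simp: abs_mult intro: mult_right_mono\<close>)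
  ultimately show ?thesis
    using set_integrable_bound[OF set_integrable_mult_right[of C lebesgue \<Omega> f]] f by blast
qed

section \<open>Integrability, increments and Lipschitz continuity of the energy\<close>

lemma energy_integrable:
  assumes "open \<Omega>" "v \<in> W11 \<Omega>" "F absolutely_integrable_on \<Omega>" "H \<in> L_infinity \<Omega>"
  shows "(\<lambda>x. norm (weak_grad \<Omega> v x + F x)) absolutely_integrable_on \<Omega>"
    and "(\<lambda>x. H x * v x) absolutely_integrable_on \<Omega>"
    and "energy \<Omega> F H v = (LINT x:\<Omega>|lebesgue. norm (weak_grad \<Omega> v x + F x)) + (LINT x:\<Omega>|lebesgue. H x * v x)"
proof -
  note v = W11D[OF assms(1,2)]
  show 1: "(\<lambda>x. norm (weak_grad \<Omega> v x + F x)) absolutely_integrable_on \<Omega>"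
    using v(3) assms(3) by (intro absolutely_integrable_norm[unfolded o_def] set_integral_add(1))
  show 2: "(\<lambda>x. H x * v x) absolutely_integrable_on \<Omega>"
    by (rule L_infinity_mult_integrable[OF assms(1,4) v(1)])
  show "energy \<Omega> F H v = (LINT x:\<Omega>|lebesgue. norm (weak_grad \<Omega> v x + F x)) + (LINT x:\<Omega>|lebesgue. H x * v x)"
    unfolding energy_def by (rule set_integral_add(2)[OF 1 2])
qed

text \<open>Linearity almost everywhere replaces the chosen gradient of u + \<phi> by that of u plus
  the classical \<open>grad \<phi>\<close>, and the terms with \<open>H u\<close> cancel.\<close>

lemma energy_add_test_function:
  assumes \<Omega>: "open \<Omega>" and u: "u \<in> W11 \<Omega>" and F: "F absolutely_integrable_on \<Omega>"
    and H: "H \<in> L_infinity \<Omega>" and \<phi>: "\<phi> \<in> test_functions \<Omega>"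
  shows "(\<lambda>x. norm (weak_grad \<Omega> u x + F x + grad \<phi> x)) absolutely_integrable_on \<Omega>"
    and "energy \<Omega> F H (\<lambda>x. u x + \<phi> x) - energy \<Omega> F H u =
      (LINT x:\<Omega>|lebesgue. norm (weak_grad \<Omega> u x + F x + grad \<phi> x) - norm (weak_grad \<Omega> u x + F x))
      + (LINT x:\<Omega>|lebesgue. H x * \<phi> x)"
proof -
  have W: "(\<lambda>x. u x + \<phi> x) \<in> W11 \<Omega>"
    using W11_add_scaled(1)[OF \<Omega> u test_function_W11[OF \<phi>], of 1] by simp
  have ae: "AE x in lebesgue. x \<in> \<Omega> \<longrightarrow>
      norm (weak_grad \<Omega> (\<lambda>x. u x + \<phi> x) x + F x) = norm (weak_grad \<Omega> u x + F x + grad \<phi> x)"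
    using W11_add_scaled(2)[OF \<Omega> u test_function_W11[OF \<phi>], of 1] weak_grad_test_function[OF \<Omega> \<phi>]
    by eventually_elim (simp add: add_ac)
  note e = energy_integrable[OF \<Omega> u F H] and e' = energy_integrable[OF \<Omega> W F H]
  show int: "(\<lambda>x. norm (weak_grad \<Omega> u x + F x + grad \<phi> x)) absolutely_integrable_on \<Omega>"
    using W11D(3)[OF \<Omega> u] F integrable_test_function(4)[OF \<phi>]
    by (intro absolutely_integrable_norm[unfolded o_def] set_integral_add(1))
  have H\<phi>: "(\<lambda>x. H x * \<phi> x) absolutely_integrable_on \<Omega>"
    by (rule L_infinity_mult_integrable[OF \<Omega> H integrable_test_function(3)[OF \<phi>]])
  have "(LINT x:\<Omega>|lebesgue. H x * (u x + \<phi> x)) = (LINT x:\<Omega>|lebesgue. H x * u x) + (LINT x:\<Omega>|lebesgue. H x * \<phi> x)"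
    unfolding distrib_left by (rule set_integral_add(2)[OF e(2) H\<phi>])
  then show "energy \<Omega> F H (\<lambda>x. u x + \<phi> x) - energy \<Omega> F H u =
      (LINT x:\<Omega>|lebesgue. norm (weak_grad \<Omega> u x + F x + grad \<phi> x) - norm (weak_grad \<Omega> u x + F x))
      + (LINT x:\<Omega>|lebesgue. H x * \<phi> x)"
    using set_integral_cong_AE_integrable[OF e'(1) int ae] e(3) e'(3) set_integral_diff(2)[OF int e(1)]
    by simp
qed

text \<open>The triangle inequality controls the gradient term with factor 1, and the essential
  bound of \<open>H\<close> controls the linear term with factor C. The constant 1 + C dominates
  both.\<close>

lemma energy_le_W11_norm:
  assumes \<Omega>: "open \<Omega>" and F: "F absolutely_integrable_on \<Omega>" and H: "H \<in> L_infinity \<Omega>"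
  obtains C where "C \<ge> 0" "\<And>v w. v \<in> W11 \<Omega> \<Longrightarrow> w \<in> W11 \<Omega> \<Longrightarrow>
    energy \<Omega> F H w \<le> energy \<Omega> F H v + C * W11_norm \<Omega> (\<lambda>x. v x - w x)"
proof -
  obtain C where C: "C \<ge> 0" "AE x in lebesgue. x \<in> \<Omega> \<longrightarrow> \<bar>H x\<bar> \<le> C"
    using L_infinity_bound[OF \<Omega> H] .
  have "energy \<Omega> F H w \<le> energy \<Omega> F H v + (1 + C) * W11_norm \<Omega> (\<lambda>x. v x - w x)"
    if v: "v \<in> W11 \<Omega>" and w: "w \<in> W11 \<Omega>" for v w
  proof -
    define d where "d x = v x - w x" for x
    have d: "d \<in> W11 \<Omega>" and ae: "AE x in lebesgue. x \<in> \<Omega> \<longrightarrow> weak_grad \<Omega> d x = weak_grad \<Omega> v x - weak_grad \<Omega> w x"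
      using W11_add_scaled[OF \<Omega> v w, of "- 1"] by (simp_all add: d_def[abs_def])
    note e = energy_integrable[OF \<Omega> v F H] and e' = energy_integrable[OF \<Omega> w F H]
    have abs_d: "(\<lambda>x. \<bar>d x\<bar>) absolutely_integrable_on \<Omega>"
      using W11D(1)[OF \<Omega> d] by (rule set_integrable_abs)
    have norm_d: "(\<lambda>x. norm (weak_grad \<Omega> d x)) absolutely_integrable_on \<Omega>"
      using absolutely_integrable_norm[OF W11D(3)[OF \<Omega> d]] by (simp add: o_def)
    have "energy \<Omega> F H w \<le> (LINT x:\<Omega>|lebesgue. (norm (weak_grad \<Omega> v x + F x) + H x * v x)
        + (norm (weak_grad \<Omega> d x) + C * \<bar>d x\<bar>))"
      unfolding energy_def
    proof (rule set_integral_mono_AE)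
      show "AE x \<in> \<Omega> in lebesgue. norm (weak_grad \<Omega> w x + F x) + H x * w x \<le>
        (norm (weak_grad \<Omega> v x + F x) + H x * v x) + (norm (weak_grad \<Omega> d x) + C * \<bar>d x\<bar>)"
        using ae C(2)
      proof eventually_elim
        case (elim x)
        show ?case
        proof
          assume x: "x \<in> \<Omega>"
          have "norm (weak_grad \<Omega> w x + F x) \<le> norm (weak_grad \<Omega> v x + F x) + norm (weak_grad \<Omega> d x)"
            using norm_triangle_ineq4[of "weak_grad \<Omega> v x + F x" "weak_grad \<Omega> d x"] elim(1) x by (simp add: add.commute)
          moreover have "- (H x * d x) \<le> \<bar>H x\<bar> * \<bar>d x\<bar>"
            using abs_ge_minus_self[of "H x * d x"] by (simp add: abs_mult)
          moreover have "\<bar>H x\<bar> * \<bar>d x\<bar> \<le> C * \<bar>d x\<bar>" using elim(2) x by (simp add: mult_right_mono)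
          ultimately show "norm (weak_grad \<Omega> w x + F x) + H x * w x \<le>
            (norm (weak_grad \<Omega> v x + F x) + H x * v x) + (norm (weak_grad \<Omega> d x) + C * \<bar>d x\<bar>)"
            by (simp add: d_def algebra_simps)
        qed
      qed
    qed (intro set_integral_add(1) e e' norm_d abs_d set_integrable_mult_right)+
    also have "\<dots> = energy \<Omega> F H v + ((LINT x:\<Omega>|lebesgue. norm (weak_grad \<Omega> d x)) + C * (LINT x:\<Omega>|lebesgue. \<bar>d x\<bar>))"
      using e norm_d abs_d by (simp add: energy_def set_integral_add)
    also have "\<dots> \<le> energy \<Omega> F H v + (1 + C) * W11_norm \<Omega> d"
    proof -
      have "0 \<le> (LINT x:\<Omega>|lebesgue. norm (weak_grad \<Omega> d x))" "0 \<le> (LINT x:\<Omega>|lebesgue. \<bar>d x\<bar>)"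
        unfolding set_lebesgue_integral_def by (auto intro!: Bochner_Integration.integral_nonneg)
      then show ?thesis using C(1) by (simp add: W11_norm_def algebra_simps)
    qed
    finally show ?thesis by (simp add: d_def[abs_def])
  qed
  then show ?thesis using C(1) by (intro that[of "1 + C"]) auto
qed

section \<open>One-sided directional derivative of the norm\<close>

definition norm_dir_deriv :: "'a::real_inner \<Rightarrow> 'a \<Rightarrow> real" where
  "norm_dir_deriv V w = (if V = 0 then norm w else (V /\<^sub>R norm V) \<bullet> w)"

text \<open>This is convexity of the norm: the increment over a unit step is at least the one-sided
  derivative. For V nonzero it is Cauchy-Schwarz for V and V + w, divided by |V|.\<close>

lemma norm_dir_deriv_le: "norm_dir_deriv V w \<le> norm (V + w) - norm V"
proof (cases "V = 0")
  case False
  have "norm V * norm V + V \<bullet> w = V \<bullet> (V + w)"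
    by (simp add: inner_add_right dot_square_norm power2_eq_square)
  also have "\<dots> \<le> norm V * norm (V + w)" by (rule norm_cauchy_schwarz)
  finally show ?thesis using False by (simp add: norm_dir_deriv_def field_simps)
qed (simp add: norm_dir_deriv_def)

lemma abs_norm_dir_deriv_le: "\<bar>norm_dir_deriv V w\<bar> \<le> norm w"
proof (cases "V = 0")
  case False
  then have "\<bar>(V /\<^sub>R norm V) \<bullet> w\<bar> \<le> 1 * norm w"
    using Cauchy_Schwarz_ineq2[of "V /\<^sub>R norm V" w] by simp
  then show ?thesis using False by (simp add: norm_dir_deriv_def)
qed (simp add: norm_dir_deriv_def)

lemma norm_dir_deriv_tendsto:
  fixes t :: "nat \<Rightarrow> real"
  assumes t: "\<And>n. t n > 0" "t \<longlonglongrightarrow> 0"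
  shows "(\<lambda>n. (norm (V + t n *\<^sub>R w) - norm V) / t n) \<longlonglongrightarrow> norm_dir_deriv V w"
proof (cases "V = 0")
  case True
  have "(norm (V + t n *\<^sub>R w) - norm V) / t n = norm w" for n
    using t(1)[of n] True by simp
  then show ?thesis using True by (simp add: norm_dir_deriv_def)
next
  case False
  \<comment> \<open>Expanding by the conjugate |V + t w| + |V| cancels the factor t, and the new
    denominator tends to 2 |V|, which is nonzero.\<close>
  have "(norm (V + t n *\<^sub>R w) - norm V) / t n =
      (2 * (V \<bullet> w) + t n * (w \<bullet> w)) / (norm (V + t n *\<^sub>R w) + norm V)" for n
  proof -
    have pos: "norm (V + t n *\<^sub>R w) + norm V > 0" using False by (simp add: add_nonneg_pos)
    have "(norm (V + t n *\<^sub>R w) - norm V) * (norm (V + t n *\<^sub>R w) + norm V)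
        = norm (V + t n *\<^sub>R w) ^ 2 - norm V ^ 2"
      by (simp add: power2_eq_square algebra_simps)
    also have "\<dots> = t n * (2 * (V \<bullet> w) + t n * (w \<bullet> w))"
      by (simp add: power2_norm_eq_inner inner_add_left inner_add_right inner_commute algebra_simps)
    finally show ?thesis using pos t(1)[of n] by (simp add: frac_eq_eq mult.commute)
  qed
  moreover have "(\<lambda>n. (2 * (V \<bullet> w) + t n * (w \<bullet> w)) / (norm (V + t n *\<^sub>R w) + norm V))
      \<longlonglongrightarrow> (2 * (V \<bullet> w) + 0 * (w \<bullet> w)) / (norm (V + 0 *\<^sub>R w) + norm V)"
    by (intro tendsto_intros t(2)) (use False in auto)
  ultimately show ?thesis using False by (simp add: norm_dir_deriv_def field_simps)
qed

text \<open>Merges the singular and regular integrals of the weak formulation into one integral over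
  \<Omega>, to which convergence and monotonicity arguments apply directly.\<close>

lemma first_variation:
  fixes \<Omega> :: "'a::euclidean_space set"
  assumes \<Omega>: "open \<Omega>" and u: "u \<in> W11 \<Omega>" and F: "F absolutely_integrable_on \<Omega>"
    and \<phi>: "\<phi> \<in> test_functions \<Omega>"
  shows "(\<lambda>x. norm_dir_deriv (weak_grad \<Omega> u x + F x) (grad \<phi> x)) absolutely_integrable_on \<Omega>"
    and "(LINT x:singular_set \<Omega> F u|lebesgue. norm (grad \<phi> x))
        + (LINT x:\<Omega> - singular_set \<Omega> F u|lebesgue. normal_field \<Omega> F u x \<bullet> grad \<phi> x)
      = (LINT x:\<Omega>|lebesgue. norm_dir_deriv (weak_grad \<Omega> u x + F x) (grad \<phi> x))"
proof -
  define V where "V x = weak_grad \<Omega> u x + F x" for x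
  \<comment> \<open>\<open>V\<close> is only controlled on \<Omega>. The truncation is measurable on
    the whole space, which yields measurability of the singular set.\<close>
  define V' where "V' x = indicator \<Omega> x *\<^sub>R V x" for x
  let ?S = "singular_set \<Omega> F u"
  have "V absolutely_integrable_on \<Omega>"
    unfolding V_def[abs_def] using W11D(3)[OF \<Omega> u] F by (rule set_integral_add(1))
  then have V'[measurable]: "V' \<in> borel_measurable lebesgue"
    by (simp add: set_integrable_def V'_def[abs_def] borel_measurable_integrable)
  note g = integrable_test_function(2,4)[OF \<phi>]
  have [measurable]: "grad \<phi> \<in> borel_measurable lebesgue" using g(1) by (rule borel_measurable_integrable)
  have [measurable]: "\<Omega> \<in> sets lebesgue" using \<Omega> by simp
  have "{x \<in> space lebesgue. V' x = 0} \<in> sets lebesgue" by measurable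
  moreover have "?S = \<Omega> \<inter> {x \<in> space lebesgue. V' x = 0}"
    by (auto simp: singular_set_def V'_def V_def)
  ultimately have S: "?S \<in> sets lebesgue" by simp
  \<comment> \<open>Off \<Omega> the truncated field is 0, so the first branch is taken there; its
    indicator factor makes the value 0.\<close>
  have "(\<lambda>x. if V' x = 0 then indicator \<Omega> x * norm (grad \<phi> x) else (V' x /\<^sub>R norm (V' x)) \<bullet> grad \<phi> x)
      \<in> borel_measurable lebesgue"
    by measurable
  also have "(\<lambda>x. if V' x = 0 then indicator \<Omega> x * norm (grad \<phi> x) else (V' x /\<^sub>R norm (V' x)) \<bullet> grad \<phi> x)
      = (\<lambda>x. indicator \<Omega> x *\<^sub>R norm_dir_deriv (V x) (grad \<phi> x))"
    by (auto simp: V'_def norm_dir_deriv_def indicator_def)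
  finally have "set_borel_measurable lebesgue \<Omega> (\<lambda>x. norm_dir_deriv (V x) (grad \<phi> x))"
    by (simp add: set_borel_measurable_def)
  from set_integrable_bound[OF g(2) this]
  have int: "(\<lambda>x. norm_dir_deriv (V x) (grad \<phi> x)) absolutely_integrable_on \<Omega>"
    using abs_norm_dir_deriv_le by (auto simp: real_norm_def)
  then show "(\<lambda>x. norm_dir_deriv (weak_grad \<Omega> u x + F x) (grad \<phi> x)) absolutely_integrable_on \<Omega>"
    by (simp add: V_def)
  have sub: "?S \<subseteq> \<Omega>" by (auto simp: singular_set_def)
  have "(LINT x:\<Omega>|lebesgue. norm_dir_deriv (V x) (grad \<phi> x))
      = (LINT x:?S \<union> (\<Omega> - ?S)|lebesgue. norm_dir_deriv (V x) (grad \<phi> x))"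
    using sub by (simp add: Un_absorb1)
  also have "\<dots> = (LINT x:?S|lebesgue. norm_dir_deriv (V x) (grad \<phi> x))
      + (LINT x:\<Omega> - ?S|lebesgue. norm_dir_deriv (V x) (grad \<phi> x))"
    by (intro set_integral_Un set_integrable_subset[OF int]) (use S sub in auto)
  also have "(LINT x:?S|lebesgue. norm_dir_deriv (V x) (grad \<phi> x)) = (LINT x:?S|lebesgue. norm (grad \<phi> x))"
    by (intro set_lebesgue_integral_cong S) (simp add: singular_set_def V_def norm_dir_deriv_def)
  also have "(LINT x:\<Omega> - ?S|lebesgue. norm_dir_deriv (V x) (grad \<phi> x))
      = (LINT x:\<Omega> - ?S|lebesgue. normal_field \<Omega> F u x \<bullet> grad \<phi> x)"
    by (intro set_lebesgue_integral_cong)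
      (use S in \<open>auto simp: singular_set_def V_def norm_dir_deriv_def normal_field_def\<close>)
  finally show "(LINT x:?S|lebesgue. norm (grad \<phi> x))
        + (LINT x:\<Omega> - ?S|lebesgue. normal_field \<Omega> F u x \<bullet> grad \<phi> x)
      = (LINT x:\<Omega>|lebesgue. norm_dir_deriv (weak_grad \<Omega> u x + F x) (grad \<phi> x))"
    by (simp add: V_def)
qed

text \<open>Minimality along \<open>t n * \<phi>\<close> makes the energy increment nonnegative.
  After division by \<open>t n\<close> > 0 the linear term no longer depends on n, and the norm
  quotients converge under the integral.\<close>

lemma minimizer_imp_first_variation_nonneg:
  fixes \<Omega> :: "'a::euclidean_space set"
  assumes \<Omega>: "open \<Omega>" and u: "u \<in> W11 \<Omega>" and F: "F absolutely_integrable_on \<Omega>"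
    and H: "H \<in> L_infinity \<Omega>" and \<phi>: "\<phi> \<in> test_functions \<Omega>" and min: "minimizer \<Omega> F H u"
  shows "0 \<le> (LINT x:\<Omega>|lebesgue. norm_dir_deriv (weak_grad \<Omega> u x + F x) (grad \<phi> x))
    + (LINT x:\<Omega>|lebesgue. H x * \<phi> x)"
proof -
  define V where "V x = weak_grad \<Omega> u x + F x" for x
  define t :: "nat \<Rightarrow> real" where "t n = inverse (real (Suc n))" for n
  have t: "t n > 0" for n by (simp add: t_def)
  have t0: "t \<longlonglongrightarrow> 0" unfolding t_def[abs_def] by (rule LIMSEQ_inverse_real_of_nat)
  define q where "q n x = (norm (V x + t n *\<^sub>R grad \<phi> x) - norm (V x)) / t n" for n x
  have int: "(\<lambda>x. norm (V x + t n *\<^sub>R grad \<phi> x) - norm (V x)) absolutely_integrable_on \<Omega>" for n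
    using energy_add_test_function(1)[OF \<Omega> u F H test_function_cmult(1)[OF \<phi>, of "t n"]]
      energy_integrable(1)[OF \<Omega> u F H]
    by (simp add: V_def test_function_cmult(2)[OF \<phi>])
  then have q_int: "q n absolutely_integrable_on \<Omega>" for n
    unfolding q_def[abs_def] by (rule set_integrable_divide)
  have pos: "0 \<le> (LINT x:\<Omega>|lebesgue. q n x) + (LINT x:\<Omega>|lebesgue. H x * \<phi> x)" for n
  proof -
    note t\<phi> = test_function_cmult(1)[OF \<phi>, of "t n"]
    have "0 \<le> energy \<Omega> F H (\<lambda>x. u x + t n * \<phi> x) - energy \<Omega> F H u"
      using min test_function_W11_0[OF \<Omega> t\<phi>] by (auto simp: minimizer_def)
    also have "\<dots> = (LINT x:\<Omega>|lebesgue. norm (V x + t n *\<^sub>R grad \<phi> x) - norm (V x))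
        + (LINT x:\<Omega>|lebesgue. t n * (H x * \<phi> x))"
      using energy_add_test_function(2)[OF \<Omega> u F H t\<phi>]
      by (simp add: V_def test_function_cmult(2)[OF \<phi>] mult.left_commute)
    also have "\<dots> = t n * ((LINT x:\<Omega>|lebesgue. q n x) + (LINT x:\<Omega>|lebesgue. H x * \<phi> x))"
      using t[of n] by (simp add: q_def distrib_left)
    finally show ?thesis using t[of n] by (simp add: zero_le_mult_iff)
  qed
  have "(\<lambda>n. LINT x:\<Omega>|lebesgue. q n x) \<longlonglongrightarrow> (LINT x:\<Omega>|lebesgue. norm_dir_deriv (V x) (grad \<phi> x))"
    unfolding set_lebesgue_integral_def
  proof (rule integral_dominated_convergence)
    show "integrable lebesgue (\<lambda>x. norm (grad \<phi> x))"
      using integrable_test_function(2)[OF \<phi>] by (rule integrable_norm)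
    show "(\<lambda>x. indicator \<Omega> x *\<^sub>R norm_dir_deriv (V x) (grad \<phi> x)) \<in> borel_measurable lebesgue"
      using first_variation(1)[OF \<Omega> u F \<phi>] by (simp add: set_integrable_def V_def borel_measurable_integrable)
    show "(\<lambda>x. indicator \<Omega> x *\<^sub>R q n x) \<in> borel_measurable lebesgue" for n
      using q_int[of n] by (simp add: set_integrable_def borel_measurable_integrable)
    show "AE x in lebesgue. (\<lambda>n. indicator \<Omega> x *\<^sub>R q n x) \<longlonglongrightarrow> indicator \<Omega> x *\<^sub>R norm_dir_deriv (V x) (grad \<phi> x)"
      unfolding q_def by (intro AE_I2 tendsto_scaleR tendsto_const norm_dir_deriv_tendsto t t0)
    \<comment> \<open>The reverse triangle inequality cancels \<open>t n\<close> and leaves a bound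
      independent of n.\<close>
    show "AE x in lebesgue. norm (indicator \<Omega> x *\<^sub>R q n x) \<le> norm (grad \<phi> x)" for n
    proof (rule AE_I2)
      fix x
      have "\<bar>norm (V x + t n *\<^sub>R grad \<phi> x) - norm (V x)\<bar> \<le> t n * norm (grad \<phi> x)"
        using norm_triangle_ineq3[of "V x + t n *\<^sub>R grad \<phi> x" "V x"] t[of n] by simp
      then have "\<bar>q n x\<bar> \<le> norm (grad \<phi> x)"
        using t[of n] by (simp add: q_def pos_divide_le_eq mult.commute)
      then show "norm (indicator \<Omega> x *\<^sub>R q n x) \<le> norm (grad \<phi> x)"
        by (simp add: indicator_def)
    qed
  qed
  then have "(\<lambda>n. (LINT x:\<Omega>|lebesgue. q n x) + (LINT x:\<Omega>|lebesgue. H x * \<phi> x))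
      \<longlonglongrightarrow> (LINT x:\<Omega>|lebesgue. norm_dir_deriv (V x) (grad \<phi> x)) + (LINT x:\<Omega>|lebesgue. H x * \<phi> x)"
    by (intro tendsto_add tendsto_const)
  then show ?thesis
    using pos unfolding V_def by (intro LIMSEQ_le_const) auto
qed

text \<open>Convexity turns the infinitesimal condition into minimality against every test function.
  Density of test functions in \<open>W11_0\<close> and the Lipschitz bound extend it to all
  competitors.\<close>

lemma first_variation_nonneg_imp_minimizer:
  fixes \<Omega> :: "'a::euclidean_space set"
  assumes \<Omega>: "open \<Omega>" and u: "u \<in> W11 \<Omega>" and F: "F absolutely_integrable_on \<Omega>"
    and H: "H \<in> L_infinity \<Omega>"
    and nonneg: "\<And>\<phi>. \<phi> \<in> test_functions \<Omega> \<Longrightarrow>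
      0 \<le> (LINT x:\<Omega>|lebesgue. norm_dir_deriv (weak_grad \<Omega> u x + F x) (grad \<phi> x))
        + (LINT x:\<Omega>|lebesgue. H x * \<phi> x)"
  shows "minimizer \<Omega> F H u"
proof -
  have test: "energy \<Omega> F H u \<le> energy \<Omega> F H (\<lambda>x. u x + \<psi> x)" if \<psi>: "\<psi> \<in> test_functions \<Omega>" for \<psi>
  proof -
    have "(LINT x:\<Omega>|lebesgue. norm_dir_deriv (weak_grad \<Omega> u x + F x) (grad \<psi> x))
      \<le> (LINT x:\<Omega>|lebesgue. norm (weak_grad \<Omega> u x + F x + grad \<psi> x) - norm (weak_grad \<Omega> u x + F x))"
      by (intro set_integral_mono first_variation(1)[OF \<Omega> u F \<psi>] set_integral_diff(1)
          energy_add_test_function(1)[OF \<Omega> u F H \<psi>] energy_integrable(1)[OF \<Omega> u F H] norm_dir_deriv_le)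
    then show ?thesis
      using nonneg[OF \<psi>] energy_add_test_function(2)[OF \<Omega> u F H \<psi>] by simp
  qed
  obtain C where C: "C \<ge> 0" "\<And>v w. v \<in> W11 \<Omega> \<Longrightarrow> w \<in> W11 \<Omega> \<Longrightarrow>
      energy \<Omega> F H w \<le> energy \<Omega> F H v + C * W11_norm \<Omega> (\<lambda>x. v x - w x)"
    using energy_le_W11_norm[OF \<Omega> F H] by blast
  have "energy \<Omega> F H u \<le> energy \<Omega> F H (\<lambda>x. u x + \<phi> x)" if \<phi>: "\<phi> \<in> W11_0 \<Omega>" for \<phi>
  proof (rule field_le_epsilon)
    fix e :: real assume "e > 0"
    \<comment> \<open>Dividing by C + 1 avoids a zero denominator when C = 0 and still gives C e /
      (C + 1) \<le> e.\<close>
    then have "e / (C + 1) > 0" using C(1) by simp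
    then obtain \<psi> where \<psi>: "\<psi> \<in> test_functions \<Omega>" "W11_norm \<Omega> (\<lambda>x. \<phi> x - \<psi> x) < e / (C + 1)"
      using \<phi> unfolding W11_0_def by blast
    have W: "(\<lambda>x. u x + \<phi> x) \<in> W11 \<Omega>" "(\<lambda>x. u x + \<psi> x) \<in> W11 \<Omega>"
      using W11_add_scaled(1)[OF \<Omega> u _, of _ 1] \<phi> test_function_W11[OF \<psi>(1)] by (auto simp: W11_0_def)
    have "C * W11_norm \<Omega> (\<lambda>x. \<phi> x - \<psi> x) \<le> C * (e / (C + 1))"
      using C(1) \<psi>(2) by (intro mult_left_mono) auto
    also have "\<dots> \<le> e" using C(1) \<open>e > 0\<close> by (simp add: field_simps)
    finally have "C * W11_norm \<Omega> (\<lambda>x. \<phi> x - \<psi> x) \<le> e" .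
    \<comment> \<open>The competitors u + \<phi> and u + \<psi> differ by \<phi> - \<psi>, so
      passing from \<psi> to \<phi> costs at most e.\<close>
    then show "energy \<Omega> F H u \<le> energy \<Omega> F H (\<lambda>x. u x + \<phi> x) + e"
      using test[OF \<psi>(1)] C(2)[OF W] by simp
  qed
  then show ?thesis using u by (auto simp: minimizer_def)
qed

theorem theorem3p3:
  fixes \<Omega> :: "(real ^ 'm) set"
    and u H :: "real ^ 'm \<Rightarrow> real"
    and F :: "real ^ 'm \<Rightarrow> real ^ 'm"
  assumes "open \<Omega>" and "connected \<Omega>" and "\<Omega> \<noteq> {}" and "bounded \<Omega>"
    and "u \<in> W11 \<Omega>"
    and "F absolutely_integrable_on \<Omega>"
    and "H \<in> L_infinity \<Omega>"
  shows "minimizer \<Omega> F H u \<longleftrightarrow> weak_solution \<Omega> F H u"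
proof -
  have "weakly_differentiable \<Omega> u"
    using assms(5) by (auto simp: W11_def weakly_differentiable_def)
  then have "weak_solution \<Omega> F H u \<longleftrightarrow> (\<forall>\<phi>\<in>test_functions \<Omega>.
      0 \<le> (LINT x:\<Omega>|lebesgue. norm_dir_deriv (weak_grad \<Omega> u x + F x) (grad \<phi> x))
        + (LINT x:\<Omega>|lebesgue. H x * \<phi> x))"
    unfolding weak_solution_def by (simp add: first_variation(2)[OF assms(1,5,6)])
  then show ?thesis
    using minimizer_imp_first_variation_nonneg[OF assms(1,5,6,7)]
      first_variation_nonneg_imp_minimizer[OF assms(1,5,6,7)] by blast
qed

end
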